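(* Let $n\ge1$ and suppose the map $\mathcal M$ is injective on $\Omega$. If the polynomial $p(t)=\sum_{j=0}^{2n+1}b_{2n+1-j}t^j$ has $2n+1$ real roots (counting multiplicity) and at least two of its roots are nonzero, then for every $M\in\mathcal M(\Omega)$ the matrix $A(M)$ has $2n+1$ distinct real eigenvalues, i.e. the $n$-node EQMOM moment system $\partial_tM+A(M)\partial_xM=S(M)$ is strictly hyperbolic on $\mathcal M(\Omega)$.
   Context: Let $\mathcal K:\mathbb R\to[0,\infty)$ be a kernel with $\mathfrak m_j:=\int_{\mathbb R}\xi^j\mathcal K(\xi)\,d\xi<\infty$ for all $j$; the kernel is assumed normalized: $\mathfrak m_0=1$, $\mathfrak m_1=0$, $\mathfrak m_2=1$. Let $\Delta_j(u,\sigma)=\int\xi^j\frac1\sigma\mathcal K(\frac{\xi-u}{\sigma})d\xi=\sum_{k=0}^j\binom jk\mathfrak m_k\sigma^ku^{j-k}$. For $W=(w_1,u_1,\dots,w_n,u_n,\sigma)$, $\mathcal M(W)=(M_0,\dots,M_{2n})^T$ with $M_j=\sum_{i=1}^nw_i\Delta_j(u_i,\sigma)$. $\Omega=\{W: w_i>0\ \forall i,\ u_1<\dots<u_n,\ \sigma>0\}$. On $\mathcal M(\Omega)$ define the closure $\mathcal M_{2n+1}(M)=\sum_{i=1}^nw_i\Delta_{2n+1}(u_i,\sigma)$ where $W=\mathcal M^{-1}(M)$, and $a_j(M)=\partial\mathcal M_{2n+1}/\partial M_j$ for $j=0,\dots,2n$. $A(M)$ is the $(2n+1)\times(2n+1)$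 matrix with ones on the superdiagonal, last row $(a_0,a_1,\dots,a_{2n})$, and zeros elsewhere. The numbers $b_j$: $b_0=1$, $b_j=-\sum_{k=1}^j\frac{\mathfrak m_k}{k!}b_{j-k}$ for $j\ge1$. Strict hyperbolicity means $A(M)$ has $2n+1$ distinct real eigenvalues. *)

theory Defs
  imports "HOL-Analysis.Analysis" "HOL-Computational_Algebra.Polynomial" "Jordan_Normal_Form.Char_Poly"
begin

definition kmom :: "(real \<Rightarrow> real) \<Rightarrow> nat \<Rightarrow> real" where
  "kmom K j = integral UNIV (\<lambda>\<xi>. \<xi> ^ j * K \<xi>)"

definition kernel_ok :: "(real \<Rightarrow> real) \<Rightarrow> bool" where
  "kernel_ok K \<longleftrightarrow> (\<forall>\<xi>. K \<xi> \<ge> 0) \<and>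
     (\<forall>j::nat. (\<lambda>\<xi>. \<xi> ^ j * K \<xi>) absolutely_integrable_on UNIV) \<and>
     kmom K 0 = 1 \<and> kmom K 1 = 0 \<and> kmom K 2 = 1"

definition Delta :: "(real \<Rightarrow> real) \<Rightarrow> nat \<Rightarrow> real \<Rightarrow> real \<Rightarrow> real" where
  "Delta K j u \<sigma> = (\<Sum>k\<le>j. real (j choose k) * kmom K k * \<sigma> ^ k * u ^ (j - k))"

text \<open>Parameter set Omega: W = (w, u, sigma) with nodes indexed 0..n-1; entries with
  index >= n are fixed to 0 so that W is a point of R^(2n+1).\<close>
definition Omega :: "nat \<Rightarrow> ((nat \<Rightarrow> real) \<times> (nat \<Rightarrow> real) \<times> real) set" where
  "Omega n = {(w, u, \<sigma>). (\<forall>i<n. w i > 0) \<and> (\<forall>i j. i < j \<and> j < n \<longrightarrow> u i < u j) \<and> \<sigma> > 0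
              \<and> (\<forall>i\<ge>n. w i = 0 \<and> u i = 0)}"

definition momap :: "(real \<Rightarrow> real) \<Rightarrow> nat \<Rightarrow> ((nat \<Rightarrow> real) \<times> (nat \<Rightarrow> real) \<times> real) \<Rightarrow> (nat \<Rightarrow> real)" where
  "momap K n W = (case W of (w, u, \<sigma>) \<Rightarrow>
     (\<lambda>j. if j \<le> 2 * n then (\<Sum>i<n. w i * Delta K j (u i) \<sigma>) else 0))"

definition closure_mom :: "(real \<Rightarrow> real) \<Rightarrow> nat \<Rightarrow> (nat \<Rightarrow> real) \<Rightarrow> real" where
  "closure_mom K n M = (case the_inv_into (Omega n) (momap K n) M of (w, u, \<sigma>) \<Rightarrow>
     (\<Sum>i<n. w i * Delta K (2 * n + 1) (u i) \<sigma>))"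

definition acoef :: "(real \<Rightarrow> real) \<Rightarrow> nat \<Rightarrow> (nat \<Rightarrow> real) \<Rightarrow> nat \<Rightarrow> real" where
  "acoef K n M j = deriv (\<lambda>t. closure_mom K n (M(j := t))) (M j)"

definition Amat :: "(real \<Rightarrow> real) \<Rightarrow> nat \<Rightarrow> (nat \<Rightarrow> real) \<Rightarrow> real mat" where
  "Amat K n M = mat (2 * n + 1) (2 * n + 1)
     (\<lambda>(i, j). if i = 2 * n then acoef K n M j else if j = i + 1 then 1 else 0)"

fun bnum :: "(real \<Rightarrow> real) \<Rightarrow> nat \<Rightarrow> real" where
  "bnum K 0 = 1"
| "bnum K (Suc j) = - (\<Sum>k\<in>{1..Suc j}. kmom K k / fact k * bnum K (Suc j - k))"

definition ppoly :: "(real \<Rightarrow> real) \<Rightarrow> nat \<Rightarrow> real poly" where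
  "ppoly K n = (\<Sum>j\<le>2 * n + 1. monom (bnum K (2 * n + 1 - j)) j)"

end

(* Write D for the derivative and F(s) = sum_k m_k s^k / k!, so that
   Delta_j(., sigma) = F(sigma D) x^j. The hypothesis on p says that, modulo s^(2n+2), F is inverse
   to B(s) = prod_i (1 - r_i s) with real r_i.

   Let c be the characteristic polynomial of A(M). By the chain rule, G = F(sigma D) c has double
   zeros at u_1, ..., u_n, so its one remaining zero is real as well. Then c = B(sigma D) G arises
   from G by the operators 1 - r_i sigma D. Each of them preserves real-rootedness; if r_i is
   nonzero it lowers every multiplicity above one, and the new zeros are simple. The multiplicities
   in G are at most three, hence two nonzero r_i suffice.

   The closure is differentiable because the Jacobian of the moment map is nonsingular: a left null
   vector is a polynomial q with F(sigma D) q = C prod (x - u_l)^2, and its sigma-derivative at the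
   nodes is a sum of the values of (1 - r_i sigma D)^(-1) prod (x - u_l)^2 over nonzero r_i. These
   are positive, being averages of a nonnegative polynomial against an exponential density.
   The local inverse is continuous by invariance of domain. *)
theory Submission
  imports Defs "HOL-Homology.Invariance_of_Domain"
begin

hide_const (open) Module.smult Coset.order up_ring.monom up_ring.coeff UnivPoly.deg

section \<open>Constant-coefficient differential operators on polynomials\<close>

text \<open>$A(D)\, q$ for the derivation $D$, by the Horner scheme in $D$.\<close>

definition dop :: "real poly \<Rightarrow> real poly \<Rightarrow> real poly" where
  "dop A q = fold_coeffs (\<lambda>a s. smult a q + pderiv s) A 0"

lemma dop_0_left [simp]: "dop 0 q = 0"
  by (simp add: dop_def)

lemma dop_pCons [simp]: "dop (pCons a A) q = smult a q + pderiv (dop A q)"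
proof (cases "pCons a A = 0")
  case False
  then have "a \<noteq> 0 \<or> A \<noteq> 0" by auto
  then show ?thesis by (auto simp: dop_def fold_coeffs_def cCons_def)
qed simp

lemma dop_1 [simp]: "dop 1 q = q"
  by (simp add: one_pCons)

lemma dop_linear: "dop [:1, - s:] p = p - smult s (pderiv p)"
  by (simp add: pderiv_minus pderiv_smult)

lemma dop_add_left: "dop (A + B) q = dop A q + dop B q"
  by (induct A B rule: poly_induct2) (simp_all add: smult_add_left pderiv_add)

lemma dop_smult_left: "dop (smult c A) q = smult c (dop A q)"
  by (induct A) (simp_all add: pderiv_smult smult_add_right)

lemma dop_minus_left: "dop (- A) q = - dop A q"
  using dop_smult_left[of "-1" A q] by simp

lemma dop_diff_left: "dop (A - B) q = dop A q - dop B q"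
  using dop_add_left[of A "- B" q] by (simp add: dop_minus_left)

lemma dop_sum_left: "dop (\<Sum>i\<in>I. A i) q = (\<Sum>i\<in>I. dop (A i) q)"
  by (induct I rule: infinite_finite_induct) (simp_all add: dop_add_left)

lemma dop_add_right: "dop A (p + q) = dop A p + dop A q"
  by (induct A) (simp_all add: pderiv_add smult_add_right)

lemma dop_smult_right: "dop A (smult c q) = smult c (dop A q)"
  by (induct A) (simp_all add: pderiv_smult smult_add_right mult.commute)

lemma dop_diff_right: "dop A (p - q) = dop A p - dop A q"
proof -
  have "dop A (- q) = - dop A q" using dop_smult_right[of A "-1" q] by simp
  then show ?thesis using dop_add_right[of A p "- q"] by simp
qed

lemma dop_0_right [simp]: "dop A 0 = 0"
  by (induct A) simp_all

lemma dop_sum_right: "dop A (\<Sum>i\<in>I. q i) = (\<Sum>i\<in>I. dop A (q i))"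
  by (induct I rule: infinite_finite_induct) (simp_all add: dop_add_right)

lemma dop_mult: "dop (A * B) q = dop A (dop B q)"
  by (induct A) (simp_all add: dop_add_left dop_smult_left)

lemma dop_monom: "dop (monom c k) q = smult c ((pderiv ^^ k) q)"
proof (induct k)
  case 0
  then show ?case by (simp add: monom_0)
next
  case (Suc k)
  then show ?case by (simp add: monom_Suc pderiv_smult)
qed

lemma higher_pderiv_eq_0: "degree (q :: real poly) < k \<Longrightarrow> (pderiv ^^ k) q = 0"
proof (induct k arbitrary: q)
  case (Suc k)
  show ?case
  proof (cases "degree q = 0")
    case True
    then have "pderiv q = 0" by (simp add: pderiv_eq_0_iff)
    moreover have "(pderiv ^^ m) (0 :: real poly) = 0" for m by (induct m) simp_all
    ultimately show ?thesis by (simp add: funpow_swap1)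
  next
    case False
    then have "degree (pderiv q) < k" using Suc.prems by (simp add: degree_pderiv)
    then show ?thesis using Suc.hyps[of "pderiv q"] by (simp add: funpow_swap1)
  qed
qed simp

text \<open>D^k kills every polynomial of degree below k. Thus identities of symbols modulo X^k,
  that is, of truncated power series, become exact identities of operators.\<close>

lemma dop_cong:
  assumes "monom 1 k dvd A - B" "degree q < k"
  shows "dop A q = dop B q"
proof -
  obtain C where C: "A - B = C * monom 1 k"
    using assms(1) by (auto elim: dvdE simp: mult.commute)
  have "dop A q - dop B q = dop C (dop (monom 1 k) q)"
    by (metis C dop_diff_left dop_mult)
  also have "\<dots> = 0" using assms(2) by (simp add: dop_monom higher_pderiv_eq_0)
  finally show ?thesis by simp
qed

lemma degree_dop_le: "degree (dop A q) \<le> degree q"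
proof (induct A)
  case (pCons a A)
  have "degree (pderiv (dop A q)) \<le> degree q"
    using pCons by (simp add: degree_pderiv)
  then show ?case by (simp add: degree_add_le)
qed simp

text \<open>D lowers degrees, so only the constant coefficient of the symbol contributes to the top
  coefficient.\<close>

lemma coeff_dop_degree: "coeff (dop A q) (degree q) = coeff A 0 * lead_coeff q"
proof (cases A)
  case (pCons a A')
  have "coeff (pderiv (dop A' q)) (degree q) = 0"
    using degree_dop_le[of A' q] by (simp add: coeff_pderiv coeff_eq_0)
  then show ?thesis by (simp add: pCons)
qed

lemma degree_dop:
  assumes "coeff A 0 \<noteq> 0" shows "degree (dop A q) = degree q"
proof (cases "q = 0")
  case False
  then have "coeff (dop A q) (degree q) \<noteq> 0" using assms by (simp add: coeff_dop_degree)
  then show ?thesis using degree_dop_le[of A q] le_degree antisym by blast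
qed simp

lemma lead_coeff_dop:
  assumes "coeff A 0 \<noteq> 0" shows "lead_coeff (dop A q) = coeff A 0 * lead_coeff q"
  by (simp add: degree_dop[OF assms] coeff_dop_degree)

lemma higher_pderiv_monom1:
  "(pderiv ^^ k) (monom (1::real) j) = (if k \<le> j then monom (fact j / fact (j - k)) (j - k) else 0)"
proof (induct k)
  case (Suc k)
  show ?case
  proof (cases "Suc k \<le> j")
    case True
    then have "j - k = Suc (j - Suc k)" by simp
    then have "fact (j - k) = real (j - k) * fact (j - Suc k)" by (metis fact_Suc of_nat_mult of_nat_fact)
    moreover have "real (j - k) \<noteq> 0" using True by simp
    moreover have "x * (a / (x * b)) = a / b" if "x \<noteq> 0" for x a b :: real
      using that by simp
    ultimately have "real (j - k) * (fact j / fact (j - k)) = fact j / fact (j - Suc k)"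
      by metis
    with True Suc show ?thesis by (simp add: pderiv_monom)
  next
    case False
    with Suc show ?thesis by (auto simp: pderiv_monom)
  qed
qed simp

section \<open>Real-rooted polynomials\<close>

declare mult_pCons_left [simp del] mult_pCons_right [simp del]

text \<open>A list of roots with multiplicity: over the reals, \<open>p = lin_prod bs\<close> says
  that \<open>p\<close> is monic with only real zeros. The type is general because the same product
  is needed over the complex numbers.\<close>

primrec lin_prod :: "'a::comm_ring_1 list \<Rightarrow> 'a poly" where
  "lin_prod [] = 1"
| "lin_prod (a # as) = [:- a, 1:] * lin_prod as"

lemma lin_prod_eq_prod_list: "lin_prod as = (\<Prod>a\<leftarrow>as. [:- a, 1:])"
  by (induct as) simp_all

lemma lin_prod_append: "lin_prod (as @ bs) = lin_prod as * lin_prod bs"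
  by (induct as) (simp_all add: mult.assoc)

lemma lin_prod_nonzero: "lin_prod as \<noteq> (0 :: 'a::idom poly)"
  by (induct as) auto

lemma degree_lin_prod: "degree (lin_prod as :: 'a::idom poly) = length as"
proof (induct as)
  case (Cons a as)
  have "degree ([:- a, 1:] * lin_prod as) = degree [:- a, 1:] + degree (lin_prod as)"
    by (rule degree_mult_eq) (use lin_prod_nonzero in simp_all)
  then show ?case using Cons by simp
qed simp

lemma lead_coeff_lin_prod: "lead_coeff (lin_prod as :: 'a::idom poly) = 1"
proof (induct as)
  case (Cons a as)
  have "lead_coeff ([:- a, 1:] * lin_prod as) = lead_coeff [:- a, 1:] * lead_coeff (lin_prod as)"
    by (rule lead_coeff_mult)
  then show ?case using Cons by simp
qed simp

lemma poly_lin_prod_eq_0_iff: "poly (lin_prod as) x = 0 \<longleftrightarrow> x \<in> set (as :: 'a::idom list)"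
  by (induct as) auto

text \<open>With L(p) = p'^2 - p p'', splitting off a factor gives L((x - a) q) = q^2 + (x - a)^2
  L(q), and both parts follow by induction. The strict part will exclude new double zeros of p - s
  p'.\<close>

lemma laguerre_inequality:
  fixes as :: "real list" and x :: real
  defines "p \<equiv> lin_prod as"
  shows "0 \<le> (poly (pderiv p) x)\<^sup>2 - poly p x * poly (pderiv (pderiv p)) x"
    and "as \<noteq> [] \<Longrightarrow> poly p x \<noteq> 0 \<Longrightarrow>
           0 < (poly (pderiv p) x)\<^sup>2 - poly p x * poly (pderiv (pderiv p)) x"
  unfolding p_def
proof (induct as)
  case (Cons a as)
  define q where "q = lin_prod as"
  define L where "L r = (poly (pderiv r) x)\<^sup>2 - poly r x * poly (pderiv (pderiv r)) x" for r
  have eq: "L ([:- a, 1:] * q) = (poly q x)\<^sup>2 + (x - a)\<^sup>2 * L q"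
    unfolding L_def by (simp add: pderiv_mult pderiv_add pderiv_pCons power2_eq_square algebra_simps)
  have nonneg: "0 \<le> L q" using Cons(1) by (simp add: L_def q_def)
  show "0 \<le> (poly (pderiv (lin_prod (a # as))) x)\<^sup>2
           - poly (lin_prod (a # as)) x * poly (pderiv (pderiv (lin_prod (a # as)))) x"
    using eq nonneg by (simp add: L_def q_def)
  assume "poly (lin_prod (a # as)) x \<noteq> 0"
  then have "poly q x \<noteq> 0" by (simp add: q_def)
  then have "0 < L ([:- a, 1:] * q)"
    unfolding eq by (intro add_pos_nonneg mult_nonneg_nonneg nonneg) simp_all
  then show "0 < (poly (pderiv (lin_prod (a # as))) x)\<^sup>2
           - poly (lin_prod (a # as)) x * poly (pderiv (pderiv (lin_prod (a # as)))) x"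
    by (simp add: L_def q_def)
qed simp_all

text \<open>The sign of the imaginary part of $p'/p = \sum_a 1/(z-a)$ off the real axis.\<close>

lemma Im_log_deriv:
  fixes as :: "real list" and z :: complex
  assumes "Im z \<noteq> 0" "as \<noteq> []"
  defines "P \<equiv> lin_prod (map complex_of_real as)"
  shows "Im z * Im (poly (pderiv P) z * cnj (poly P z)) < 0"
  using assms(2) unfolding P_def
proof (induct as)
  case (Cons a as)
  define Q where "Q = lin_prod (map complex_of_real as)"
  \<comment> \<open>Where R(z) is nonzero, \<open>J R\<close> is Im z times |R(z)|^2 times Im
    (R'/R)(z). A new root a scales the old value by |z - a|^2 and adds -(Im z)^2 |Q(z)|^2.\<close>
  define J where "J R = Im z * Im (poly (pderiv R) z * cnj (poly R z))" for R
  have Q0: "poly Q z \<noteq> 0"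
    using assms(1) by (auto simp: Q_def poly_lin_prod_eq_0_iff)
  have "poly (pderiv ([:- of_real a, 1:] * Q)) z * cnj (poly ([:- of_real a, 1:] * Q) z)
      = cnj (z - of_real a) * (poly Q z * cnj (poly Q z))
        + ((z - of_real a) * cnj (z - of_real a)) * (poly (pderiv Q) z * cnj (poly Q z))"
    by (simp add: pderiv_mult pderiv_pCons algebra_simps)
  also have "\<dots> = cnj (z - of_real a) * of_real ((cmod (poly Q z))\<^sup>2)
        + of_real ((cmod (z - of_real a))\<^sup>2) * (poly (pderiv Q) z * cnj (poly Q z))"
    by (simp only: complex_norm_square)
  finally have *: "poly (pderiv ([:- of_real a, 1:] * Q)) z * cnj (poly ([:- of_real a, 1:] * Q) z)
      = cnj (z - of_real a) * of_real ((cmod (poly Q z))\<^sup>2)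
        + of_real ((cmod (z - of_real a))\<^sup>2) * (poly (pderiv Q) z * cnj (poly Q z))" .
  have "Im (c * of_real x + of_real y * d) = Im c * x + y * Im d" for c d x y
    by simp
  then have "J ([:- of_real a, 1:] * Q)
      = - ((Im z)\<^sup>2 * (cmod (poly Q z))\<^sup>2) + (cmod (z - of_real a))\<^sup>2 * J Q"
    unfolding J_def * by (simp only:) (simp add: power2_eq_square algebra_simps)
  moreover have "0 < (Im z)\<^sup>2 * (cmod (poly Q z))\<^sup>2"
    using assms(1) Q0 by simp
  moreover have "J Q \<le> 0"
    using Cons.hyps by (cases "as = []") (auto simp: J_def Q_def)
  then have "(cmod (z - of_real a))\<^sup>2 * J Q \<le> 0"
    by (simp add: mult_nonneg_nonpos)
  ultimately show ?case by (simp add: J_def Q_def)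
qed simp

text \<open>At a nonreal zero of $p - s p'$ the logarithmic derivative of $p$ would be the real number $1/s$.\<close>

lemma real_rooted_minus_pderiv:
  fixes as :: "real list" and s :: real
  obtains bs where "lin_prod as - smult s (pderiv (lin_prod as)) = lin_prod bs"
proof (cases "as = []")
  case True
  then have "lin_prod as - smult s (pderiv (lin_prod as)) = lin_prod []"
    by (simp add: pderiv_1)
  then show ?thesis by (rule that)
next
  case False
  interpret h: map_poly_inj_idom_hom "of_real :: real \<Rightarrow> complex" ..
  define p where "p = lin_prod as"
  define P where "P = lin_prod (map complex_of_real as)"
  define q where "q = p - smult s (pderiv p)"
  define Q where "Q = map_poly complex_of_real q"
  have lin: "map_poly complex_of_real (lin_prod xs) = lin_prod (map of_real xs)" for xs
    by (induct xs) (simp_all add: h.hom_mult map_poly_pCons)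
  have Q: "Q = P - smult (of_real s) (pderiv P)"
    by (simp add: Q_def q_def P_def p_def h.hom_minus lin[symmetric] of_real_hom.map_poly_pderiv
        of_real_hom.map_poly_hom_smult)
  have q_dop: "q = dop [:1, - s:] p"
    by (simp add: q_def dop_linear del: dop_pCons)
  have lcq: "lead_coeff q = 1"
    unfolding q_dop by (subst lead_coeff_dop) (simp_all add: p_def lead_coeff_lin_prod)
  have "lead_coeff Q = 1"
    using lcq by (simp add: Q_def)
  \<comment> \<open>The factorization is first taken over the complex numbers; once all roots are
    known to be real, their real parts factor \<open>q\<close> itself.\<close>
  then obtain zs where zs: "lin_prod zs = Q"
    using fundamental_theorem_algebra_factorized[of Q] by (auto simp: lin_prod_eq_prod_list)
  have real: "Im z = 0" if "z \<in> set zs" for z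
  proof (rule ccontr)
    assume im: "Im z \<noteq> 0"
    have "poly Q z = 0" using that zs poly_lin_prod_eq_0_iff by metis
    then have Pz: "poly P z = of_real s * poly (pderiv P) z" by (simp add: Q)
    have "poly (pderiv P) z * cnj (poly P z) = of_real s * (poly (pderiv P) z * cnj (poly (pderiv P) z))"
      unfolding Pz by simp
    also have "\<dots> = of_real (s * (cmod (poly (pderiv P) z))\<^sup>2)"
      by (simp only: complex_norm_square of_real_mult)
    finally have "Im (poly (pderiv P) z * cnj (poly P z)) = 0"
      by (simp only: Im_complex_of_real)
    then show False using Im_log_deriv[OF im False] by (simp add: P_def)
  qed
  have "map of_real (map Re zs) = zs"
    using real by (simp add: map_idI complex_eq_iff)
  then have "map_poly complex_of_real (lin_prod (map Re zs)) = map_poly complex_of_real q"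
    using zs Q_def lin by metis
  then have "q = lin_prod (map Re zs)" by (simp add: h.eq_iff)
  then show ?thesis using that by (simp add: q_def p_def)
qed

text \<open>At a zero of p of order k the derivative has order k - 1, so p - s p' has order below k.
  Where p does not vanish, a double zero would give p = s p' and p' = s p'', against the strict
  Laguerre inequality.\<close>

lemma order_minus_pderiv_le:
  fixes as :: "real list" and s :: real
  assumes "s \<noteq> 0" and ord: "\<And>a. order a (lin_prod as) \<le> m"
  shows "order a (lin_prod as - smult s (pderiv (lin_prod as))) \<le> max 1 (m - 1)"
proof (cases "as = []")
  case True
  then show ?thesis by (simp add: pderiv_1)
next
  case False
  define p where "p = lin_prod as"
  define q where "q = p - smult s (pderiv p)"
  have p0: "p \<noteq> 0" by (simp add: p_def lin_prod_nonzero)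
  have "lead_coeff (dop [:1, - s:] p) = 1"
    by (subst lead_coeff_dop) (simp_all add: p_def lead_coeff_lin_prod)
  then have q0: "q \<noteq> 0" 
    unfolding q_def dop_linear by (metis leading_coeff_0_iff zero_neq_one)
  show ?thesis
  proof (cases "poly p a = 0")
    case True
    then have ord_p: "order a p = Suc (order a (pderiv p))"
      using order_pderiv p0 by blast
    have "degree p \<noteq> 0" using False by (simp add: p_def degree_lin_prod)
    then have "pderiv p \<noteq> 0" by (simp add: pderiv_eq_0_iff)
    have "\<not> order a p \<le> order a q"
    proof
      assume le: "order a p \<le> order a q"
      have "[:- a, 1:] ^ order a p dvd p - q"
        using le order_divides q0 order_1 by (metis dvd_diff)
      also have "p - q = smult s (pderiv p)" by (simp add: q_def)
      finally have "[:- a, 1:] ^ order a p dvd pderiv p"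
        using assms(1) by (simp add: dvd_smult_iff)
      then show False
        using \<open>pderiv p \<noteq> 0\<close> unfolding order_divides ord_p by simp
    qed
    then show ?thesis using ord[of a] by (simp add: p_def q_def)
  next
    case pa: False
    show ?thesis
    proof (cases "poly q a = 0")
      case True
      have "poly (pderiv q) a \<noteq> 0"
      proof
        assume "poly (pderiv q) a = 0"
        then have "poly (pderiv p) a = s * poly (pderiv (pderiv p)) a"
          by (simp add: q_def pderiv_diff pderiv_smult)
        moreover have "poly p a = s * poly (pderiv p) a"
          using True by (simp add: q_def)
        ultimately have "(poly (pderiv p) a)\<^sup>2 - poly p a * poly (pderiv (pderiv p)) a = 0"
          by (simp add: power2_eq_square)
        then show False
          using laguerre_inequality(2)[OF False, of a] pa by (simp add: p_def)
      qed
      then have "order a (pderiv q) = 0" by (rule order_0I)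
      then have "order a q = 1" using order_pderiv[OF q0 True] by simp
      then show ?thesis by (simp add: q_def p_def)
    next
      case False
      then have "order a q = 0" by (rule order_0I)
      then show ?thesis by (simp add: q_def p_def)
    qed
  qed
qed

text \<open>The factors are applied one after another. Those with \<open>s i = 0\<close> are the
  identity; each other one lowers the bound on the multiplicities by one until it reaches 1.\<close>

lemma dop_prod_real_rooted:
  fixes as :: "real list" and s :: "'i \<Rightarrow> real"
  assumes "finite I" and "\<And>a. order a (lin_prod as) \<le> m"
  shows "\<exists>bs. dop (\<Prod>i\<in>I. [:1, - s i:]) (lin_prod as) = lin_prod bs \<and>
     (\<forall>a. order a (lin_prod bs) \<le> max 1 (m - card {i \<in> I. s i \<noteq> 0}))"
  using assms(1)
proof (induct I)
  case empty
  have "\<forall>a. order a (lin_prod as) \<le> max 1 (m - card {i \<in> {}. s i \<noteq> 0})"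
    using assms(2) le_max_iff_disj by auto
  then show ?case by auto
next
  case (insert j I)
  let ?c = "card {i \<in> I. s i \<noteq> 0}"
  from insert obtain bs where bs: "dop (\<Prod>i\<in>I. [:1, - s i:]) (lin_prod as) = lin_prod bs"
    and ord: "\<And>a. order a (lin_prod bs) \<le> max 1 (m - ?c)" by auto
  obtain cs where cs: "lin_prod bs - smult (s j) (pderiv (lin_prod bs)) = lin_prod cs"
    by (rule real_rooted_minus_pderiv)
  have "dop (\<Prod>i\<in>insert j I. [:1, - s i:]) (lin_prod as) = lin_prod cs"
    using insert.hyps(1,2) by (simp add: dop_mult bs cs dop_linear del: dop_pCons)
  moreover have "order a (lin_prod cs) \<le> max 1 (m - card {i \<in> insert j I. s i \<noteq> 0})" for a
  proof (cases "s j = 0")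
    case True
    then have "{i \<in> insert j I. s i \<noteq> 0} = {i \<in> I. s i \<noteq> 0}" by auto
    then show ?thesis using True cs ord[of a] by simp
  next
    case False
    then have "{i \<in> insert j I. s i \<noteq> 0} = insert j {i \<in> I. s i \<noteq> 0}" by auto
    then have "card {i \<in> insert j I. s i \<noteq> 0} = Suc ?c" using insert by simp
    moreover have "order a (lin_prod cs) \<le> max 1 (max 1 (m - ?c) - 1)"
      using order_minus_pderiv_le[OF False ord] cs by simp
    moreover have "max 1 (max 1 (m - c) - 1) = max 1 (m - Suc c)" for c :: nat by arith
    ultimately show ?thesis by metis
  qed
  ultimately show ?case by blast
qed

lemma distinct_if_simple:
  assumes "\<And>a. order a (lin_prod bs :: 'a::idom poly) \<le> 1"
  shows "distinct bs"
proof (rule ccontr)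
  assume "\<not> distinct bs"
  then obtain xs ys zs a where "bs = xs @ [a] @ ys @ [a] @ zs"
    using not_distinct_decomp by blast
  then have "lin_prod bs = [:- a, 1:] ^ 2 * (lin_prod xs * lin_prod ys * lin_prod zs)"
    by (simp add: lin_prod_append power2_eq_square ac_simps)
  then have "[:- a, 1:] ^ 2 dvd lin_prod bs" by (metis dvd_triv_left)
  then show False using assms[of a] lin_prod_nonzero[of bs] by (auto simp: order_divides)
qed

section \<open>Positivity of the resolvent\<close>

text \<open>The function $e^{-x/s} k(x)$ is decreasing, so $k(u) \leq 0$ would force $k \leq 0$ to the
  right of $u$, against the positive leading coefficient.\<close>

lemma resolvent_pos_if_pos:
  fixes k g :: "real poly" and s u :: real
  assumes s: "s > 0" and eq: "dop [:1, - s:] k = g"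
    and nonneg: "\<And>x. poly g x \<ge> 0" and lc: "lead_coeff g > 0" and deg: "degree g > 0"
  shows "poly k u > 0"
proof (rule ccontr)
  assume neg: "\<not> poly k u > 0"
  have deg_k: "degree k = degree g" and lc_k: "lead_coeff k = lead_coeff g"
    using degree_dop[of "[:1, - s:]" k] lead_coeff_dop[of "[:1, - s:]" k] eq
    by (simp_all del: dop_pCons)
  \<comment> \<open>\<open>k\<close> shares its degree and leading coefficient with
    \<open>g\<close>, so it is eventually at least 1.\<close>
  obtain N where N: "\<And>x. x \<ge> N \<Longrightarrow> poly k x \<ge> 1"
    using poly_pinfty_ge[of k 1] lc deg by (metis deg_k lc_k not_gr_zero)
  define x where "x = max u N"
  define f where "f y = exp (- y / s) * poly k y" for y
  have "f x \<le> f u"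
  proof (rule DERIV_nonpos_imp_nonincreasing[where f = f])
    show "u \<le> x" by (simp add: x_def)
  next
    fix y assume "u \<le> y" "y \<le> x"
    have "(f has_real_derivative exp (- y / s) * (- 1 / s) * poly k y
             + poly (pderiv k) y * exp (- y / s)) (at y)"
      unfolding f_def by (rule derivative_eq_intros poly_DERIV | use s in simp)+
    \<comment> \<open>(e^(-y/s) k)' = e^(-y/s) (k' - k/s) = -(1/s) e^(-y/s) g.\<close>
    moreover have "exp (- y / s) * (- 1 / s) * poly k y + poly (pderiv k) y * exp (- y / s)
        = - (exp (- y / s) / s) * poly g y"
      using s unfolding eq[symmetric] dop_linear by (simp add: field_simps)
    moreover have "- (exp (- y / s) / s) * poly g y \<le> 0"
      using s nonneg[of y] by simp
    ultimately show "\<exists>z. (f has_real_derivative z) (at y) \<and> z \<le> 0" by auto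
  qed
  moreover have "f u \<le> 0" using neg by (simp add: f_def mult_nonneg_nonpos)
  moreover have "f x > 0" using N[of x] by (simp add: f_def x_def)
  ultimately show False by simp
qed

lemma pderiv_reflect: "pderiv (p \<circ>\<^sub>p [:0, - 1:]) = - (pderiv p \<circ>\<^sub>p [:0, - 1 :: real:])"
  by (simp add: pderiv_pcompose pderiv_pCons mult_pCons_right)

text \<open>The reflection x -> -x turns D into -D and so reduces negative s to positive s; the even
  degree keeps the leading coefficient positive.\<close>

lemma resolvent_pos:
  fixes k g :: "real poly" and s u :: real
  assumes s: "s \<noteq> 0" and eq: "dop [:1, - s:] k = g"
    and nonneg: "\<And>x. poly g x \<ge> 0" and lc: "lead_coeff g > 0"
    and deg: "degree g > 0" "even (degree g)"
  shows "poly k u > 0"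
proof (cases "s > 0")
  case True
  then show ?thesis using resolvent_pos_if_pos assms by blast
next
  case False
  define k' where "k' = k \<circ>\<^sub>p [:0, - 1:]"
  define g' where "g' = g \<circ>\<^sub>p [:0, - 1:]"
  have "poly k' (- u) > 0"
  proof (rule resolvent_pos_if_pos)
    show "- s > 0" using s False by simp
    show "dop [:1, - (- s):] k' = g'"
      unfolding dop_linear k'_def g'_def eq[symmetric] pderiv_reflect
      by (simp add: pcompose_diff pcompose_smult)
    show "poly g' x \<ge> 0" for x using nonneg by (simp add: g'_def poly_pcompose)
    show "lead_coeff g' > 0"
      unfolding g'_def using lc deg by (subst lead_coeff_comp) simp_all
    show "degree g' > 0" using deg by (simp add: g'_def)
  qed
  then show ?thesis by (simp add: k'_def poly_pcompose)
qed

section \<open>The squared node polynomial\<close>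

definition sq_prod :: "nat \<Rightarrow> (nat \<Rightarrow> real) \<Rightarrow> real poly" where
  "sq_prod n u = (\<Prod>i<n. [:- u i, 1:] ^ 2)"

lemma sq_prod_eq_lin_prod:
  "sq_prod n u = lin_prod (map u [0..<n]) * lin_prod (map u [0..<n])"
  by (induct n) (simp_all add: sq_prod_def lin_prod_append power2_eq_square ac_simps)

lemma degree_sq_prod: "degree (sq_prod n u) = 2 * n"
  using degree_mult_eq[of "lin_prod (map u [0..<n])" "lin_prod (map u [0..<n])"]
  by (simp add: sq_prod_eq_lin_prod lin_prod_nonzero degree_lin_prod)

lemma lead_coeff_sq_prod: "lead_coeff (sq_prod n u) = 1"
  unfolding sq_prod_eq_lin_prod lead_coeff_mult lead_coeff_lin_prod by simp

lemma poly_sq_prod_nonneg: "poly (sq_prod n u) x \<ge> 0"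
  by (simp add: sq_prod_eq_lin_prod)

lemma order_lin_prod: "order a (lin_prod bs :: 'a::idom poly) = count_list bs a"
proof (induct bs)
  case (Cons b bs)
  have "[:- b, 1:] * lin_prod bs \<noteq> 0"
    using lin_prod_nonzero[of "b # bs"] by simp
  then show ?case using Cons by (simp add: order_mult order_linear')
qed (simp add: order_0I)

text \<open>Induction on the number of nodes: \<open>sq_prod n u\<close> does not vanish at the new
  node, so the double zero of \<open>g\<close> there belongs to the cofactor.\<close>

lemma sq_prod_dvd:
  assumes "inj_on u {..<n}"
    and "\<And>i. i < n \<Longrightarrow> poly g (u i) = 0" "\<And>i. i < n \<Longrightarrow> poly (pderiv g) (u i) = 0"
  shows "sq_prod n u dvd g"
  using assms
proof (induct n)
  case 0
  then show ?case by (simp add: sq_prod_def)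
next
  case (Suc n)
  have "inj_on u {..<n}" using Suc.prems(1) by (rule inj_on_subset) auto
  then obtain h where h: "g = sq_prod n u * h" using Suc by (auto elim!: dvdE)
  have "[:- u n, 1:] ^ 2 dvd h"
  proof (cases "g = 0")
    case True
    then show ?thesis using h degree_sq_prod lead_coeff_sq_prod[of n u] by auto
  next
    case False
    have "order (u n) g \<ge> 2"
    proof (cases "pderiv g = 0")
      case True
      then have "degree g = 0" by (simp add: pderiv_eq_0_iff)
      then show ?thesis using Suc.prems(2)[of n] False by (auto elim: degree_eq_zeroE)
    next
      case pg: False
      have "order (u n) g = Suc (order (u n) (pderiv g))"
        using False Suc.prems(2)[of n] by (intro order_pderiv) simp_all
      moreover have "order (u n) (pderiv g) \<noteq> 0"
        using Suc.prems(3)[of n] pg order_root by blast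
      ultimately show ?thesis by simp
    qed
    moreover have "poly (sq_prod n u) (u n) \<noteq> 0"
    proof -
      have "u i \<noteq> u n" if "i < n" for i
        using inj_onD[OF Suc.prems(1), of i n] that by auto
      then show ?thesis by (fastforce simp: sq_prod_eq_lin_prod poly_lin_prod_eq_0_iff)
    qed
    then have "order (u n) (sq_prod n u) = 0" by (rule order_0I)
    moreover have "order (u n) g = order (u n) (sq_prod n u) + order (u n) h"
      using False unfolding h by (rule order_mult)
    ultimately show ?thesis by (simp add: order_divides)
  qed
  then have "sq_prod n u * [:- u n, 1:] ^ 2 dvd g" unfolding h by (rule mult_dvd_mono[OF dvd_refl])
  then show ?case by (simp add: sq_prod_def)
qed

section \<open>Nonsingularity of the Jacobian\<close>

text \<open>The symbol $\sum_{k \leq N} m_k (\sigma X)^k / k!$ of the operator that maps $x^j$ to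
  $\Delta_j(\cdot, \sigma)$, and its derivative in $\sigma$.\<close>

definition sym_poly :: "(nat \<Rightarrow> real) \<Rightarrow> nat \<Rightarrow> real \<Rightarrow> real poly" where
  "sym_poly m N \<sigma> = (\<Sum>k\<le>N. monom (m k / fact k * \<sigma> ^ k) k)"

definition dsym_poly :: "(nat \<Rightarrow> real) \<Rightarrow> nat \<Rightarrow> real \<Rightarrow> real poly" where
  "dsym_poly m N \<sigma> = (\<Sum>k\<le>N. monom (m k / fact k * (real k * \<sigma> ^ (k - 1))) k)"

lemma dop_sym_poly:
  "dop (sym_poly m N \<sigma>) q = (\<Sum>k\<le>N. smult (m k / fact k * \<sigma> ^ k) ((pderiv ^^ k) q))"
  by (simp add: sym_poly_def dop_sum_left dop_monom)

lemma dop_dsym_poly: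
  "dop (dsym_poly m N \<sigma>) q = (\<Sum>k\<le>N. smult (m k / fact k * (real k * \<sigma> ^ (k - 1))) ((pderiv ^^ k) q))"
  by (simp add: dsym_poly_def dop_sum_left dop_monom)

text \<open>The symbol depends on sigma and X only through their product, so sigma d/dsigma and X
  d/dX agree on it.\<close>

lemma smult_dsym_poly: "smult \<sigma> (dsym_poly m N \<sigma>) = monom 1 1 * pderiv (sym_poly m N \<sigma>)"
proof -
  have "\<sigma> * (real k * \<sigma> ^ (k - 1)) = real k * \<sigma> ^ k" for k
    by (cases k) simp_all
  then have "smult \<sigma> (monom (m k / fact k * (real k * \<sigma> ^ (k - 1))) k)
      = monom 1 1 * pderiv (monom (m k / fact k * \<sigma> ^ k) k)" for k
    by (cases k) (simp_all add: pderiv_monom smult_monom mult_monom mult.assoc mult.left_commute)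
  then show ?thesis
    by (simp add: sym_poly_def dsym_poly_def smult_sum2 pderiv_sum sum_distrib_left)
qed

text \<open>D^k x^j / k! = (j choose k) x^(j-k), which is 0 for k > j. Hence one truncation order N
  serves all moments of order up to N.\<close>

lemma Delta_eq_dop:
  assumes "j \<le> N"
  shows "Delta K j u \<sigma> = poly (dop (sym_poly (kmom K) N \<sigma>) (monom 1 j)) u"
proof -
  have "poly (dop (sym_poly (kmom K) N \<sigma>) (monom 1 j)) u
      = (\<Sum>k\<le>N. if k \<le> j then kmom K k / fact k * \<sigma> ^ k * (fact j / fact (j - k) * u ^ (j - k)) else 0)"
    unfolding dop_sym_poly poly_sum
    by (rule sum.cong) (simp_all add: higher_pderiv_monom1 poly_monom)
  also have "\<dots> = (\<Sum>k\<le>j. kmom K k / fact k * \<sigma> ^ k * (fact j / fact (j - k) * u ^ (j - k)))"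
    by (rule sum.mono_neutral_cong_right) (use assms in auto)
  also have "\<dots> = Delta K j u \<sigma>"
    unfolding Delta_def by (rule sum.cong) (simp_all add: binomial_fact)
  finally show ?thesis ..
qed

section \<open>Operators inverse to a product of linear factors, modulo X^(N+1)\<close>

context
  fixes s :: "'i \<Rightarrow> real" and I :: "'i set" and F B :: "real poly" and N :: nat
  assumes fin: "finite I" and B_def: "B = (\<Prod>i\<in>I. [:1, - s i:])"
    and BF: "monom 1 (Suc N) dvd B * F - 1"
begin

lemma dop_prod_inverse:
  assumes "degree q \<le> N" shows "dop B (dop F q) = q"
  using dop_cong[OF BF, of q] assms by (simp add: dop_mult)

text \<open>Removing the i-th factor from B and multiplying by F gives 1/(1 - s_i X) modulo X^(N+1).
  So the resolvent of F(D) q is again given by a polynomial symbol.\<close>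

lemma resolvent_eq:
  assumes "i \<in> I" "degree q \<le> N"
  shows "dop [:1, - s i:] (dop ((\<Prod>j\<in>I - {i}. [:1, - s j:]) * F * F) q) = dop F q"
proof -
  have "B = [:1, - s i:] * (\<Prod>j\<in>I - {i}. [:1, - s j:])"
    unfolding B_def using fin assms(1) by (simp add: prod.remove)
  then have "[:1, - s i:] * ((\<Prod>j\<in>I - {i}. [:1, - s j:]) * F * F) - F = (B * F - 1) * F"
    by (simp add: algebra_simps)
  then have "monom 1 (Suc N) dvd [:1, - s i:] * ((\<Prod>j\<in>I - {i}. [:1, - s j:]) * F * F) - F"
    using BF by (simp add: dvd_mult2)
  then have "dop ([:1, - s i:] * ((\<Prod>j\<in>I - {i}. [:1, - s j:]) * F * F)) q = dop F q"
    by (rule dop_cong) (use assms(2) in simp)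
  then show ?thesis by (simp only: dop_mult)
qed

text \<open>Logarithmic differentiation of $F = 1/B$ modulo $X^{N+1}$: each factor contributes
  $s_i X / (1 - s_i X) = 1 / (1 - s_i X) - 1$.\<close>

lemma log_derivative_dvd:
  "monom 1 (Suc N) dvd
     monom 1 1 * pderiv F - (\<Sum>i\<in>I. ((\<Prod>j\<in>I - {i}. [:1, - s j:]) * F - 1) * F)"
proof -
  define Bi where "Bi i = (\<Prod>j\<in>I - {i}. [:1, - s j:])" for i
  define X where "X = (monom 1 1 :: real poly)"
  define R where "R = B * F - 1"
  obtain C where C: "R = monom 1 (Suc N) * C" using BF by (auto simp: R_def elim: dvdE)
  have split: "B = Bi i - smult (s i) X * Bi i" if "i \<in> I" for i
  proof -
    have "B = [:1, - s i:] * Bi i"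
      unfolding B_def Bi_def using fin that by (simp add: prod.remove)
    also have "[:1, - s i:] = 1 - smult (s i) X"
      by (simp add: X_def monom_Suc monom_0 one_pCons)
    finally show ?thesis by (simp add: algebra_simps)
  qed
  have pB: "pderiv B = - (\<Sum>i\<in>I. smult (s i) (Bi i))"
    unfolding B_def pderiv_prod Bi_def[symmetric]
    by (simp add: pderiv_pCons mult_pCons_right sum_negf)
  have "(\<Sum>i\<in>I. (Bi i * F - 1) * F) = (\<Sum>i\<in>I. (smult (s i) X * Bi i * F + R) * F)"
  proof (rule sum.cong)
    fix i assume "i \<in> I"
    have "Bi i * F - 1 = (Bi i - smult (s i) X * Bi i) * F + smult (s i) X * Bi i * F - 1"
      by (simp add: algebra_simps)
    also have "\<dots> = smult (s i) X * Bi i * F + R"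
      unfolding split[OF \<open>i \<in> I\<close>, symmetric] R_def by simp
    finally show "(Bi i * F - 1) * F = (smult (s i) X * Bi i * F + R) * F" by simp
  qed simp
  also have "\<dots> = X * (\<Sum>i\<in>I. smult (s i) (Bi i)) * F * F + of_nat (card I) * R * F"
    by (simp add: sum.distrib sum_distrib_left sum_distrib_right algebra_simps)
  finally have sum_eq: "(\<Sum>i\<in>I. (Bi i * F - 1) * F)
      = X * (\<Sum>i\<in>I. smult (s i) (Bi i)) * F * F + of_nat (card I) * R * F" .
  have pR: "pderiv R = pderiv B * F + B * pderiv F"
    by (simp add: R_def pderiv_diff pderiv_mult pderiv_1 algebra_simps)
  \<comment> \<open>Every term on the right has a factor R or X R'.\<close>
  have eq: "X * pderiv F - (\<Sum>i\<in>I. (Bi i * F - 1) * F)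
      = X * pderiv R * F - X * pderiv F * R - of_nat (card I) * R * F"
    unfolding sum_eq pR pB by (simp add: R_def algebra_simps)
  \<comment> \<open>R' alone would only be divisible by X^N; the factor X restores the exponent N +
    1.\<close>
  have "X * pderiv R = monom 1 (Suc N) * (of_nat (Suc N) * C + X * pderiv C)"
  proof -
    have "X * pderiv (monom 1 (Suc N)) = of_nat (Suc N) * monom 1 (Suc N)"
      by (simp add: X_def pderiv_monom mult_monom of_nat_poly mult_pCons_left smult_monom del: of_nat_Suc)
    then show ?thesis
      unfolding C pderiv_mult by (simp add: algebra_simps)
  qed
  then have "monom 1 (Suc N) dvd X * pderiv R" by simp
  moreover have "monom 1 (Suc N) dvd R" by (simp add: C)
  ultimately have "monom 1 (Suc N) dvd
      X * pderiv R * F - X * pderiv F * R - of_nat (card I) * R * F"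
    by (simp add: dvd_diff dvd_mult dvd_mult2)
  then show ?thesis unfolding X_def[symmetric] Bi_def[symmetric] eq .
qed

text \<open>Degree and double zeros force F(D) q = c prod (x - u_l)^2. If c were nonzero, the sum in
  \<open>zero\<close> divided by c would be a positively weighted sum of resolvent values at the
  nodes, all nonnegative and some positive.\<close>

lemma sum_dsigma_eq_0_imp_zero:
  fixes u w :: "nat \<Rightarrow> real"
  assumes n: "n \<ge> 1" "2 * n \<le> N" and w: "\<And>l. l < n \<Longrightarrow> w l > 0" and u: "inj_on u {..<n}"
    and nz: "\<exists>i\<in>I. s i \<noteq> 0" and deg: "degree q \<le> 2 * n"
    and g0: "\<And>l. l < n \<Longrightarrow> poly (dop F q) (u l) = 0"
    and g1: "\<And>l. l < n \<Longrightarrow> poly (pderiv (dop F q)) (u l) = 0"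
    and zero: "(\<Sum>l<n. w l * poly (dop (monom 1 1 * pderiv F) q) (u l)) = 0"
  shows "q = 0"
proof -
  define g where "g = dop F q"
  define k where "k i = dop ((\<Prod>j\<in>I - {i}. [:1, - s j:]) * F * F) q" for i
  have degN: "degree q \<le> N" using deg n by simp
  have k_eq: "dop [:1, - s i:] (k i) = g" if "i \<in> I" for i
    using resolvent_eq[OF that degN] by (simp add: k_def g_def del: dop_pCons)
  obtain h where h: "g = sq_prod n u * h"
    using sq_prod_dvd[OF u, of g] g0 g1 unfolding g_def dvd_def by blast
  have "g = 0"
  proof (rule ccontr)
    assume g: "g \<noteq> 0"
    have "degree g \<le> 2 * n" using degree_dop_le[of F q] deg by (simp add: g_def)
    moreover have "degree g = 2 * n + degree h"
      using g unfolding h by (subst degree_mult_eq) (auto simp: degree_sq_prod)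
    ultimately obtain c where c: "h = [:c:]" by (metis add_le_same_cancel1 degree_eq_zeroE le_zero_eq)
    with g h have gc: "g = smult c (sq_prod n u)" "c \<noteq> 0" by (auto simp: mult_pCons_right)
    \<comment> \<open>\<open>c\<close> may be negative, so signs are compared after division by
      \<open>c\<close>.\<close>
    have pos: "poly (k i) (u l) / c > 0" if "i \<in> I" "s i \<noteq> 0" for i l
    proof -
      have "dop [:1, - s i:] (smult (1 / c) (k i)) = sq_prod n u"
        using k_eq[OF that(1)] gc by (simp only: dop_smult_right) simp
      then have "poly (smult (1 / c) (k i)) (u l) > 0"
        by (rule resolvent_pos[OF that(2)])
          (use n lead_coeff_sq_prod[of n u] in
            \<open>simp_all add: poly_sq_prod_nonneg degree_sq_prod\<close>)
      then show ?thesis by simp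
    qed
    have gu: "poly g (u l) = 0" if "l < n" for l using g0[OF that] by (simp add: g_def)
    \<comment> \<open>For \<open>s i = 0\<close> the resolvent is \<open>g\<close> itself, which
      vanishes at the nodes.\<close>
    have zero': "poly (k i) (u l) = 0" if "i \<in> I" "s i = 0" "l < n" for i l
      using k_eq[OF that(1)] that gu by (simp add: one_pCons[symmetric])
    have dsig: "dop (monom 1 1 * pderiv F) q = (\<Sum>i\<in>I. k i - g)"
    proof -
      have "dop (monom 1 1 * pderiv F) q
          = dop (\<Sum>i\<in>I. ((\<Prod>j\<in>I - {i}. [:1, - s j:]) * F - 1) * F) q"
        by (rule dop_cong[OF log_derivative_dvd]) (use degN in simp)
      also have "\<dots> = (\<Sum>i\<in>I. k i - g)"
        by (simp add: dop_sum_left k_def g_def left_diff_distrib dop_diff_left)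
      finally show ?thesis .
    qed
    have "(\<Sum>l<n. w l * poly (dop (monom 1 1 * pderiv F) q) (u l)) / c
        = (\<Sum>l<n. w l * (\<Sum>i\<in>I. poly (k i) (u l) / c))"
      unfolding dsig sum_divide_distrib
      by (rule sum.cong) (simp_all add: poly_sum gu sum_divide_distrib[symmetric])
    moreover have "\<dots> > 0"
    proof (rule sum_pos)
      fix l assume "l \<in> {..<n}"
      then have l: "l < n" by simp
      obtain i where i: "i \<in> I" "s i \<noteq> 0" using nz by blast
      have "(\<Sum>i\<in>I. poly (k i) (u l) / c) > 0"
      proof (rule sum_pos2)
        show "0 < poly (k i) (u l) / c" using pos i by blast
        show "0 \<le> poly (k j) (u l) / c" if "j \<in> I" for j
          using pos[OF that, of l] zero'[OF that _ l] by (cases "s j = 0") auto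
      qed (use fin i in auto)
      then show "0 < w l * (\<Sum>i\<in>I. poly (k i) (u l) / c)" using w[OF l] by simp
    qed (use n in \<open>auto simp: lessThan_empty_iff\<close>)
    ultimately show False using zero by simp
  qed
  then show ?thesis using dop_prod_inverse[OF degN] by (simp add: g_def)
qed

end

section \<open>Derivatives along the inverse of an injective map\<close>

unbundle no vec_syntax

text \<open>The matrix \<open>A\<close> below is the transpose of \<open>J\<close>; a trivial kernel
  gives a nonzero determinant and hence an inverse. It serves twice: for the closure coefficients
  and for a left inverse of the Jacobian.\<close>

lemma surj_of_trivial_left_kernel:
  fixes J :: "nat \<Rightarrow> nat \<Rightarrow> real" and y :: "nat \<Rightarrow> real"
  assumes ker: "\<forall>x. (\<forall>i<N. (\<Sum>k<N. x k * J k i) = 0) \<longrightarrow> (\<forall>k<N. x k = 0)"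
  shows "\<exists>x. \<forall>i<N. (\<Sum>k<N. x k * J k i) = y i"
proof -
  define A where "A = mat N N (\<lambda>(i, k). J k i)"
  have A: "A \<in> carrier_mat N N" by (simp add: A_def)
  have entry: "(A *\<^sub>v v) $ i = (\<Sum>k<N. v $ k * J k i)" if "v \<in> carrier_vec N" "i < N" for v i
    using that by (simp add: A_def scalar_prod_def atLeast0LessThan mult.commute)
  have "det A \<noteq> 0"
  proof
    assume "det A = 0"
    then obtain v where v: "v \<in> carrier_vec N" "v \<noteq> 0\<^sub>v N" "A *\<^sub>v v = 0\<^sub>v N"
      using det_0_iff_vec_prod_zero_field[OF A] by blast
    have "\<forall>i<N. (\<Sum>k<N. v $ k * J k i) = 0"
      using entry[OF v(1)] v(3) by force
    then have "\<forall>k<N. v $ k = 0" using spec[OF ker, of "\<lambda>k. v $ k"] by simp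
    then have "v = 0\<^sub>v N" using v(1) by auto
    then show False using v(2) by simp
  qed
  then obtain B where B: "B \<in> carrier_mat N N" "A * B = 1\<^sub>m N"
    using det_non_zero_imp_unit[OF A, of "()"] by (auto simp: Units_def ring_mat_def)
  define v where "v = B *\<^sub>v vec N y"
  have v: "v \<in> carrier_vec N" using B by (simp add: v_def)
  have "A *\<^sub>v v = (A * B) *\<^sub>v vec N y"
    using A B unfolding v_def by (intro assoc_mult_mat_vec[symmetric]) auto
  then have "A *\<^sub>v v = vec N y" by (simp add: B)
  then have "(\<Sum>k<N. v $ k * J k i) = y i" if "i < N" for i
    using entry[OF v that] that by simp
  then show ?thesis by blast
qed

text \<open>By invariance of domain, \<open>f\<close> is a homeomorphism from \<open>U\<close> onto
  an open set. So the line through \<open>f z0\<close> that changes only coordinate \<open>j\<close>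
  stays in the image near \<open>f z0\<close> and can be pulled back continuously.\<close>

lemma inverse_path:
  fixes F :: "nat \<Rightarrow> (nat \<Rightarrow> real) \<Rightarrow> real" and U :: "(nat \<Rightarrow> real) set" and N :: nat
  assumes f_def: "f = (\<lambda>z k. if k < N then F k z else 0)"
    and U: "openin (Euclidean_space N) U"
    and cont: "\<And>k. k < N \<Longrightarrow> continuous_on U (F k)"
    and inj: "inj_on f U" and z0: "z0 \<in> U" and j: "j < N"
  obtains Z where "\<And>i. ((\<lambda>t. Z t i) \<longlongrightarrow> z0 i) (at (f z0 j))"
    and "\<forall>\<^sub>F t in nhds (f z0 j). Z t \<in> U \<and> f (Z t) = (f z0)(j := t)"
    and "Z (f z0 j) = z0"
proof -
  \<comment> \<open>R^N is realized as the functions vanishing from index N on, which is why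
    \<open>f\<close> is padded with zeros.\<close>
  define E where "E = {x :: nat \<Rightarrow> real. \<forall>i\<ge>N. x i = 0}"
  have Eu: "Euclidean_space N = top_of_set E"
    by (simp add: Euclidean_space_def euclidean_product_topology E_def)
  have U_sub: "U \<subseteq> E" using openin_subset[OF U] by (simp add: Eu)
  have sub: "subtopology (Euclidean_space N) T = top_of_set T" if "T \<subseteq> E" for T
    using that by (simp add: Eu subtopology_subtopology inf.absorb2)
  have cm: "continuous_map (subtopology (Euclidean_space N) U) (Euclidean_space N) f"
    unfolding f_def continuous_map_componentwise_Euclidean_space sub[OF U_sub]
    using cont by simp
  have fU: "f ` U \<subseteq> E" by (auto simp: f_def E_def)
  have "embedding_map (top_of_set U) (Euclidean_space N) f"
    using invariance_of_domain_Euclidean_space_embedding_map[OF U cm inj] by (simp add: sub[OF U_sub])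
  then obtain g where "homeomorphic_maps (top_of_set U) (top_of_set (f ` U)) f g"
    by (auto simp: embedding_map_def homeomorphic_map_maps sub[OF fU])
  then have g_cont: "continuous_on (f ` U) g" and gf: "\<And>z. z \<in> U \<Longrightarrow> g (f z) = z"
    by (auto simp: homeomorphic_maps_def)
  obtain W where W: "open W" "f ` U = E \<inter> W"
    using invariance_of_domain_Euclidean_space[OF U cm inj] by (auto simp: Eu openin_open)
  define p where "p t = (f z0)(j := t)" for t
  have p_cont: "continuous_on UNIV p"
    unfolding p_def
  proof (rule continuous_on_coordinatewise_then_product)
    show "continuous_on UNIV (\<lambda>t. ((f z0)(j := t)) i)" for i by (cases "i = j") simp_all
  qed
  have pE: "p t \<in> E" for t using j by (auto simp: p_def E_def f_def)
  have open_T: "open (p -` W)" using open_vimage[OF W(1) p_cont] .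
  have p_in: "p t \<in> f ` U" if "t \<in> p -` W" for t using that pE W(2) by auto
  have p0: "p (f z0 j) = f z0" by (simp add: p_def)
  have t0: "f z0 j \<in> p -` W" using z0 W(2) p0 by auto
  define Z where "Z t = g (p t)" for t
  have "continuous_on (p -` W) Z"
    unfolding Z_def using p_in
    by (intro continuous_on_compose2[OF g_cont continuous_on_subset[OF p_cont]]) auto
  then have "continuous_on (p -` W) (\<lambda>t. Z t i)" for i
    by (rule continuous_on_product_then_coordinatewise)
  then have "isCont (\<lambda>t. Z t i) (f z0 j)" for i
    using open_T t0 continuous_on_eq_continuous_at by blast
  moreover have Z0: "Z (f z0 j) = z0" using gf[OF z0] by (simp add: Z_def p0)
  ultimately have "((\<lambda>t. Z t i) \<longlongrightarrow> z0 i) (at (f z0 j))" for i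
    by (metis isCont_def)
  moreover have "\<forall>\<^sub>F t in nhds (f z0 j). Z t \<in> U \<and> f (Z t) = (f z0)(j := t)"
  proof -
    have "Z t \<in> U \<and> f (Z t) = (f z0)(j := t)" if t: "t \<in> p -` W" for t
    proof -
      obtain z where "z \<in> U" "f z = p t" using p_in[OF t] by (metis imageE)
      then show ?thesis using gf[of z] by (simp add: Z_def p_def)
    qed
    then show ?thesis using eventually_nhds_in_open[OF open_T t0] by (auto elim: eventually_mono)
  qed
  ultimately show ?thesis using that Z0 by blast
qed

text \<open>The path is not known to be differentiable. A left inverse of \<open>D\<close> makes
  each coordinate of z - z0 a multiple of t - t0 up to o(S); absorbing this error yields S = O(t -
  t0). Then all errors are o(t - t0), and the row combination \<open>a\<close> gives the
  slope.\<close>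

lemma deriv_along_inverse_path:
  fixes z :: "real \<Rightarrow> nat \<Rightarrow> real" and \<phi> :: "nat \<Rightarrow> real \<Rightarrow> real" and \<psi> :: "real \<Rightarrow> real"
    and D :: "nat \<Rightarrow> nat \<Rightarrow> real" and a d z0 :: "nat \<Rightarrow> real" and N :: nat
  defines "S \<equiv> \<lambda>t. \<Sum>i<N. \<bar>z t i - z0 i\<bar>"
  assumes j: "j < N"
    and D: "\<And>k. k < N \<Longrightarrow>
      (\<lambda>t. \<phi> k t - \<phi> k t0 - (\<Sum>i<N. D k i * (z t i - z0 i))) \<in> o[at t0](S)"
    and d: "(\<lambda>t. \<psi> t - \<psi> t0 - (\<Sum>i<N. d i * (z t i - z0 i))) \<in> o[at t0](S)"
    and path: "\<And>k. k < N \<Longrightarrow> \<forall>\<^sub>F t in at t0. \<phi> k t - \<phi> k t0 = (if k = j then t - t0 else 0)"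
    and a: "\<And>i. i < N \<Longrightarrow> (\<Sum>k<N. a k * D k i) = d i"
    and left_inv: "\<And>i. i < N \<Longrightarrow> \<exists>x. \<forall>l<N. (\<Sum>k<N. x k * D k l) = (if l = i then 1 else 0)"
  shows "(\<psi> has_real_derivative a j) (at t0)"
proof -
  \<comment> \<open>Only the j-th function moves along the path, so combining the expansions with
    coefficients \<open>x\<close> leaves x_j (t - t0).\<close>
  have comb: "(\<lambda>t. (\<Sum>i<N. y i * (z t i - z0 i)) - x j * (t - t0)) \<in> o[at t0](S)"
    if xy: "\<And>i. i < N \<Longrightarrow> (\<Sum>k<N. x k * D k i) = y i" for x y
  proof -
    have sm: "(\<lambda>t. - (\<Sum>k<N. x k * (\<phi> k t - \<phi> k t0 - (\<Sum>i<N. D k i * (z t i - z0 i))))) \<in> o[at t0](S)"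
      using D by (auto intro!: big_sum_in_smallo)
    have ev: "\<forall>\<^sub>F t in at t0. - (\<Sum>k<N. x k * (\<phi> k t - \<phi> k t0 - (\<Sum>i<N. D k i * (z t i - z0 i))))
        = (\<Sum>i<N. y i * (z t i - z0 i)) - x j * (t - t0)"
    proof -
      have "\<forall>\<^sub>F t in at t0. \<forall>k\<in>{..<N}. \<phi> k t - \<phi> k t0 = (if k = j then t - t0 else 0)"
        using path by (intro eventually_ball_finite) auto
      then show ?thesis
      proof (rule eventually_mono)
        fix t assume t: "\<forall>k\<in>{..<N}. \<phi> k t - \<phi> k t0 = (if k = j then t - t0 else 0)"
        have "(\<Sum>k<N. x k * (\<phi> k t - \<phi> k t0)) = (\<Sum>k<N. if k = j then x j * (t - t0) else 0)"
          using t by (intro sum.cong) auto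
        also have "\<dots> = x j * (t - t0)" using j by simp
        finally have 1: "(\<Sum>k<N. x k * (\<phi> k t - \<phi> k t0)) = x j * (t - t0)" .
        have "(\<Sum>k<N. x k * (\<Sum>i<N. D k i * (z t i - z0 i)))
            = (\<Sum>i<N. (\<Sum>k<N. x k * D k i) * (z t i - z0 i))"
          unfolding sum_distrib_left sum_distrib_right by (subst sum.swap) (simp add: mult.assoc)
        also have "\<dots> = (\<Sum>i<N. y i * (z t i - z0 i))" using xy by simp
        finally have 2: "(\<Sum>k<N. x k * (\<Sum>i<N. D k i * (z t i - z0 i)))
            = (\<Sum>i<N. y i * (z t i - z0 i))" .
        have "(\<Sum>k<N. x k * (p k - q k)) = (\<Sum>k<N. x k * p k) - (\<Sum>k<N. x k * q k)" for p q
          by (simp add: right_diff_distrib sum_subtractf)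
        then show "- (\<Sum>k<N. x k * (\<phi> k t - \<phi> k t0 - (\<Sum>i<N. D k i * (z t i - z0 i))))
            = (\<Sum>i<N. y i * (z t i - z0 i)) - x j * (t - t0)"
          by (simp only: 1 2 minus_diff_eq)
      qed
    qed
    show ?thesis by (rule iffD1[OF landau_o.small.in_cong[OF ev] sm])
  qed
  have coord: "\<exists>c. (\<lambda>t. (z t i - z0 i) - c * (t - t0)) \<in> o[at t0](S)" if i: "i < N" for i
  proof -
    obtain x where x: "\<And>l. l < N \<Longrightarrow> (\<Sum>k<N. x k * D k l) = (if l = i then 1 else 0)"
      using left_inv[OF i] by blast
    have "(\<Sum>l<N. (if l = i then 1 else 0) * (z t l - z0 l)) = z t i - z0 i" for t
    proof -
      have "(\<Sum>l<N. (if l = i then 1 else 0) * (z t l - z0 l))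
          = (\<Sum>l<N. if l = i then z t l - z0 l else 0)"
        by (rule sum.cong) simp_all
      then show ?thesis using i by simp
    qed
    then show ?thesis using comb[OF x] by auto
  qed
  then obtain c where c: "\<And>i. i < N \<Longrightarrow> (\<lambda>t. (z t i - z0 i) - c i * (t - t0)) \<in> o[at t0](S)"
    by metis
  have S0: "S t \<ge> 0" for t by (simp add: S_def sum_nonneg)
  have "(\<lambda>t. \<Sum>i<N. \<bar>(z t i - z0 i) - c i * (t - t0)\<bar>) \<in> o[at t0](S)"
    using c by (auto intro!: big_sum_in_smallo)
  \<comment> \<open>The constant 1/2 gives S <= S/2 + C |t - t0|, so that S can be absorbed; hence
    the factor 2 in the next bound.\<close>
  then have "\<forall>\<^sub>F t in at t0. norm (\<Sum>i<N. \<bar>(z t i - z0 i) - c i * (t - t0)\<bar>) \<le> 1 / 2 * norm (S t)"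
    by (rule landau_o.smallD) simp
  then have "\<forall>\<^sub>F t in at t0. norm (S t) \<le> (2 * (\<Sum>i<N. \<bar>c i\<bar>)) * norm (t - t0)"
  proof (rule eventually_mono)
    fix t assume t: "norm (\<Sum>i<N. \<bar>(z t i - z0 i) - c i * (t - t0)\<bar>) \<le> 1 / 2 * norm (S t)"
    have "S t \<le> (\<Sum>i<N. \<bar>(z t i - z0 i) - c i * (t - t0)\<bar> + \<bar>c i\<bar> * \<bar>t - t0\<bar>)"
      unfolding S_def
    proof (rule sum_mono)
      fix i
      show "\<bar>z t i - z0 i\<bar> \<le> \<bar>(z t i - z0 i) - c i * (t - t0)\<bar> + \<bar>c i\<bar> * \<bar>t - t0\<bar>"
        unfolding abs_mult[symmetric] by linarith
    qed
    also have "\<dots> = (\<Sum>i<N. \<bar>(z t i - z0 i) - c i * (t - t0)\<bar>) + (\<Sum>i<N. \<bar>c i\<bar>) * \<bar>t - t0\<bar>"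
      by (simp add: sum.distrib sum_distrib_right)
    finally show "norm (S t) \<le> (2 * (\<Sum>i<N. \<bar>c i\<bar>)) * norm (t - t0)"
      using t S0[of t] by (simp add: abs_of_nonneg sum_nonneg)
  qed
  then have SO: "S \<in> O[at t0](\<lambda>t. t - t0)" by (rule bigoI)
  have "(\<lambda>t. (\<psi> t - \<psi> t0 - (\<Sum>i<N. d i * (z t i - z0 i)))
      + ((\<Sum>i<N. d i * (z t i - z0 i)) - a j * (t - t0))) \<in> o[at t0](S)"
    by (rule sum_in_smallo(1)[OF d comb[of a d, OF a]])
  then have "(\<lambda>t. \<psi> t - \<psi> t0 - a j * (t - t0)) \<in> o[at t0](S)"
    by (simp add: add_diff_eq)
  then have "(\<lambda>t. \<psi> t - \<psi> t0 - a j * (t - t0)) \<in> o[at t0](\<lambda>t. t - t0)"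
    using SO by (rule landau_o.small_big_trans)
  then have "((\<lambda>t. (\<psi> t - \<psi> t0 - a j * (t - t0)) / (t - t0)) \<longlongrightarrow> 0) (at t0)"
    by (rule smalloD_tendsto)
  then have "((\<lambda>t. (\<psi> t - \<psi> t0 - a j * (t - t0)) / (t - t0) + a j) \<longlongrightarrow> 0 + a j) (at t0)"
    by (intro tendsto_add tendsto_const)
  moreover have "\<forall>\<^sub>F t in at t0. (\<psi> t - \<psi> t0 - a j * (t - t0)) / (t - t0) + a j
      = (\<psi> t - \<psi> t0) / (t - t0)"
    by (simp add: eventually_at_filter field_simps)
  ultimately have "((\<lambda>t. (\<psi> t - \<psi> t0) / (t - t0)) \<longlongrightarrow> a j) (at t0)"
    by (simp add: tendsto_cong)
  then show ?thesis by (simp add: has_field_derivative_iff)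
qed

section \<open>Companion matrices and the moment map\<close>

text \<open>The superdiagonal rows force an eigenvector to be a multiple of (1, x, ..., x^m); the
  last row is then the equation for x.\<close>

lemma eigenvalue_companion_iff:
  fixes a :: "nat \<Rightarrow> real" and x :: real and m :: nat
  defines "A \<equiv> mat (m + 1) (m + 1) (\<lambda>(i, j). if i = m then a j else if j = i + 1 then 1 else 0)"
  shows "eigenvalue A x \<longleftrightarrow> x ^ (m + 1) = (\<Sum>j<m + 1. a j * x ^ j)"
proof -
  have entry: "(A *\<^sub>v v) $ i = (if i = m then \<Sum>j<m + 1. a j * v $ j else v $ (i + 1))"
    if v: "v \<in> carrier_vec (m + 1)" and i: "i < m + 1" for v i
  proof -
    have "(A *\<^sub>v v) $ i = (\<Sum>j<m + 1. (if i = m then a j else if j = i + 1 then 1 else 0) * v $ j)"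
      using v i by (simp add: A_def scalar_prod_def atLeast0LessThan del: sum.lessThan_Suc)
    also have "\<dots> = (if i = m then \<Sum>j<m + 1. a j * v $ j else v $ (i + 1))"
    proof (cases "i = m")
      case False
      have "(\<Sum>j<m + 1. (if j = i + 1 then 1 else 0) * v $ j)
          = (\<Sum>j<m + 1. if j = i + 1 then v $ j else 0)"
        by (rule sum.cong) simp_all
      also have "\<dots> = v $ (i + 1)" using False i by (subst sum.delta) auto
      finally show ?thesis using False by simp
    qed simp
    finally show ?thesis .
  qed
  show ?thesis
  proof
    assume "eigenvalue A x"
    then obtain v where v: "v \<in> carrier_vec (m + 1)" "v \<noteq> 0\<^sub>v (m + 1)" "A *\<^sub>v v = x \<cdot>\<^sub>v v"
      by (auto simp: eigenvalue_def eigenvector_def A_def)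
    have row: "(A *\<^sub>v v) $ i = x * v $ i" if "i < m + 1" for i
      using v that by simp
    have pow: "v $ i = x ^ i * v $ 0" if "i < m + 1" for i
      using that
    proof (induct i)
      case (Suc i)
      then have "v $ (i + 1) = x * v $ i" using entry[OF v(1), of i] row[of i] by simp
      then show ?case using Suc by simp
    qed simp
    have "v $ 0 \<noteq> 0"
    proof
      assume "v $ 0 = 0"
      then have "v $ i = 0" if "i < m + 1" for i using pow[OF that] by simp
      then have "v = 0\<^sub>v (m + 1)" using v(1) by auto
      then show False using v(2) by simp
    qed
    moreover have "(\<Sum>j<m + 1. a j * x ^ j) * v $ 0 = x ^ (m + 1) * v $ 0"
    proof -
      have "(\<Sum>j<m + 1. a j * x ^ j) * v $ 0 = (\<Sum>j<m + 1. a j * v $ j)"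
        unfolding sum_distrib_right
      proof (rule sum.cong)
        show "a j * x ^ j * v $ 0 = a j * v $ j" if "j \<in> {..<m + 1}" for j
          using pow[of j] that by simp
      qed simp
      also have "\<dots> = x * v $ m" using entry[OF v(1), of m] row[of m] by simp
      also have "\<dots> = x ^ (m + 1) * v $ 0" using pow[of m] by simp
      finally show ?thesis .
    qed
    ultimately show "x ^ (m + 1) = (\<Sum>j<m + 1. a j * x ^ j)" by simp
  next
    assume x: "x ^ (m + 1) = (\<Sum>j<m + 1. a j * x ^ j)"
    define v where "v = vec (m + 1) (\<lambda>i. x ^ i)"
    have v: "v \<in> carrier_vec (m + 1)" by (simp add: v_def)
    have "v $ 0 \<noteq> 0\<^sub>v (m + 1) $ 0" by (simp add: v_def)
    then have "v \<noteq> 0\<^sub>v (m + 1)" by auto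
    moreover have "A *\<^sub>v v = x \<cdot>\<^sub>v v"
    proof (rule eq_vecI)
      fix i assume "i < dim_vec (x \<cdot>\<^sub>v v)"
      then have i: "i < m + 1" by (simp add: v_def)
      have "(\<Sum>j<m + 1. a j * v $ j) = (\<Sum>j<m + 1. a j * x ^ j)"
        by (rule sum.cong) (simp_all add: v_def)
      then show "(A *\<^sub>v v) $ i = (x \<cdot>\<^sub>v v) $ i"
        unfolding entry[OF v i] using i x by (simp add: v_def del: sum.lessThan_Suc)
    qed (simp add: A_def v_def)
    ultimately show "eigenvalue A x"
      using v by (auto simp: eigenvalue_def eigenvector_def A_def)
  qed
qed

section \<open>First-order expansion of the moments along a path\<close>

lemma smallo_of_has_derivative:
  fixes h :: "'a::real_normed_vector \<Rightarrow> real"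
  assumes h: "(h has_derivative h') (at x)" and W: "(W \<longlongrightarrow> x) F"
  shows "(\<lambda>t. h (W t) - h x - h' (W t - x)) \<in> o[F](\<lambda>t. norm (W t - x))"
proof (rule landau_o.smallI)
  fix c :: real assume "c > 0"
  then obtain d where d: "d > 0"
    "\<And>y. norm (y - x) < d \<Longrightarrow> norm (h y - h x - h' (y - x)) \<le> c * norm (y - x)"
    using h unfolding has_derivative_at_alt by blast
  have "\<forall>\<^sub>F t in F. dist (W t) x < d" using W d(1) by (rule tendstoD)
  then show "\<forall>\<^sub>F t in F. norm (h (W t) - h x - h' (W t - x)) \<le> c * norm (norm (W t - x))"
    by (rule eventually_mono) (use d(2) in \<open>simp add: dist_norm\<close>)
qed

lemma poly_has_derivative:
  fixes f :: "'a::real_normed_vector \<Rightarrow> real"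
  assumes "(f has_derivative f') (at x)"
  shows "((\<lambda>y. poly p (f y)) has_derivative (\<lambda>h. poly (pderiv p) (f x) * f' h)) (at x)"
  by (rule has_derivative_compose[OF assms])
    (use poly_DERIV[of p "f x"] in \<open>simp add: has_field_derivative_def\<close>)

text \<open>The calculus is done for one node at a time, in R^3; a moment is a sum of such terms
  with a common sigma.\<close>

lemma node_has_derivative:
  fixes w u \<sigma> :: real
  shows "((\<lambda>(w, u, \<sigma>). w * poly (dop (sym_poly m N \<sigma>) q) u) has_derivative
    (\<lambda>(dw, du, d\<sigma>). poly (dop (sym_poly m N \<sigma>) q) u * dw
       + w * poly (pderiv (dop (sym_poly m N \<sigma>) q)) u * du
       + w * poly (dop (dsym_poly m N \<sigma>) q) u * d\<sigma>)) (at (w, u, \<sigma>))"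
proof -
  let ?q = "\<lambda>k. (pderiv ^^ k) q"
  have pd: "pderiv (dop (sym_poly m N \<sigma>) q)
      = (\<Sum>k\<le>N. smult (m k / fact k * \<sigma> ^ k) (pderiv (?q k)))"
    by (simp add: dop_sym_poly pderiv_sum pderiv_smult)
  have s: "((\<lambda>z. snd (snd z)) has_derivative (\<lambda>h. snd (snd h))) (at (w, u, \<sigma>))"
    and uu: "((\<lambda>z. fst (snd z)) has_derivative (\<lambda>h. fst (snd h))) (at (w, u, \<sigma>))"
    for w u \<sigma> :: real
    by (auto intro!: derivative_eq_intros)
  have "((\<lambda>z. fst z * (\<Sum>k\<le>N. m k / fact k * snd (snd z) ^ k * poly (?q k) (fst (snd z))))
    has_derivative
      (\<lambda>h. fst (w, u, \<sigma>) * (\<Sum>k\<le>N. m k / fact k * snd (snd (w, u, \<sigma>)) ^ k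
              * (poly (pderiv (?q k)) (fst (snd (w, u, \<sigma>))) * fst (snd h))
            + m k / fact k * (of_nat k * snd (snd h) * snd (snd (w, u, \<sigma>)) ^ (k - 1))
              * poly (?q k) (fst (snd (w, u, \<sigma>))))
          + fst h * (\<Sum>k\<le>N. m k / fact k * snd (snd (w, u, \<sigma>)) ^ k
              * poly (?q k) (fst (snd (w, u, \<sigma>)))))) (at (w, u, \<sigma>))"
    by (intro has_derivative_mult has_derivative_sum has_derivative_mult_right
        has_derivative_power has_derivative_fst has_derivative_ident poly_has_derivative s uu)
  moreover have "(\<lambda>(w, u, \<sigma>). w * poly (dop (sym_poly m N \<sigma>) q) u)
      = (\<lambda>z. fst z * (\<Sum>k\<le>N. m k / fact k * snd (snd z) ^ k * poly (?q k) (fst (snd z))))"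
    by (auto simp: dop_sym_poly poly_sum)
  moreover have "(\<lambda>h. fst (w, u, \<sigma>) * (\<Sum>k\<le>N. m k / fact k * snd (snd (w, u, \<sigma>)) ^ k
              * (poly (pderiv (?q k)) (fst (snd (w, u, \<sigma>))) * fst (snd h))
            + m k / fact k * (of_nat k * snd (snd h) * snd (snd (w, u, \<sigma>)) ^ (k - 1))
              * poly (?q k) (fst (snd (w, u, \<sigma>))))
          + fst h * (\<Sum>k\<le>N. m k / fact k * snd (snd (w, u, \<sigma>)) ^ k
              * poly (?q k) (fst (snd (w, u, \<sigma>)))))
    = (\<lambda>(dw, du, d\<sigma>). poly (dop (sym_poly m N \<sigma>) q) u * dw
       + w * poly (pderiv (dop (sym_poly m N \<sigma>) q)) u * du
       + w * poly (dop (dsym_poly m N \<sigma>) q) u * d\<sigma>)"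
    unfolding pd unfolding dop_sym_poly dop_dsym_poly
    by (simp add: fun_eq_iff poly_sum sum.distrib sum_distrib_left sum_distrib_right algebra_simps)
  ultimately show ?thesis by simp
qed

text \<open>The parameter triple is stored in one vector:
  $w_l = z_l$, $u_l = z_{n+l}$ for $l < n$, and $\sigma = z_{2n}$.\<close>

definition moment :: "(nat \<Rightarrow> real) \<Rightarrow> nat \<Rightarrow> real poly \<Rightarrow> (nat \<Rightarrow> real) \<Rightarrow> real" where
  "moment m n q z = (\<Sum>l<n. z l * poly (dop (sym_poly m (2 * n + 1) (z (2 * n))) q) (z (n + l)))"

text \<open>The gradient of \<open>moment m n q\<close> at \<open>z\<close>, in the blocks of
  weights, nodes and sigma. In the middle block \<open>z i\<close> is the node and
  \<open>z (i - n)\<close> its weight.\<close>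

definition dmoment :: "(nat \<Rightarrow> real) \<Rightarrow> nat \<Rightarrow> real poly \<Rightarrow> (nat \<Rightarrow> real) \<Rightarrow> nat \<Rightarrow> real" where
  "dmoment m n q z i =
     (if i < n then poly (dop (sym_poly m (2 * n + 1) (z (2 * n))) q) (z (n + i))
      else if i < 2 * n
        then z (i - n) * poly (pderiv (dop (sym_poly m (2 * n + 1) (z (2 * n))) q)) (z i)
      else \<Sum>l<n. z l * poly (dop (dsym_poly m (2 * n + 1) (z (2 * n))) q) (z (n + l)))"

lemma sum_blocks:
  fixes f :: "nat \<Rightarrow> real"
  shows "(\<Sum>i<2 * n + 1. f i) = (\<Sum>l<n. f l) + (\<Sum>l<n. f (n + l)) + f (2 * n)"
proof -
  have "(\<Sum>i<a + b. f i) = (\<Sum>l<a. f l) + (\<Sum>l<b. f (a + l))" for a b :: nat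
    by (induct b) simp_all
  from this[of n n] show ?thesis by (simp add: mult_2)
qed

lemma moment_expansion:
  assumes Z: "\<And>i. ((\<lambda>t. Z t i) \<longlongrightarrow> z0 i) F"
  shows "(\<lambda>t. moment m n q (Z t) - moment m n q z0
            - (\<Sum>i<2 * n + 1. dmoment m n q z0 i * (Z t i - z0 i)))
         \<in> o[F](\<lambda>t. \<Sum>i<2 * n + 1. \<bar>Z t i - z0 i\<bar>)"
proof -
  define S where "S t = (\<Sum>i<2 * n + 1. \<bar>Z t i - z0 i\<bar>)" for t
  define N where "N = 2 * n + 1"
  define h where "h = (\<lambda>(w, u, \<sigma>). w * poly (dop (sym_poly m N \<sigma>) q) u)"
  define W where "W l t = (Z t l, Z t (n + l), Z t (2 * n))" for l t
  define W0 where "W0 l = (z0 l, z0 (n + l), z0 (2 * n))" for l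
  define T where "T = dop (sym_poly m N (z0 (2 * n))) q"
  define E where "E = dop (dsym_poly m N (z0 (2 * n))) q"
  define h' where "h' l = (\<lambda>(dw, du, d\<sigma>). poly T (z0 (n + l)) * dw
       + z0 l * poly (pderiv T) (z0 (n + l)) * du
       + z0 l * poly E (z0 (n + l)) * d\<sigma>)" for l
  have h: "(h has_derivative h' l) (at (W0 l))" for l
    unfolding h_def h'_def W0_def T_def E_def by (rule node_has_derivative)
  have W: "(W l \<longlongrightarrow> W0 l) F" for l
    unfolding W_def W0_def by (intro tendsto_Pair Z)
  have small: "(\<lambda>t. h (W l t) - h (W0 l) - h' l (W l t - W0 l)) \<in> o[F](S)" if l: "l < n" for l
  proof (rule landau_o.small_big_trans[OF smallo_of_has_derivative[OF h W]])
    \<comment> \<open>Each of the three coordinates changes by at most S, hence the constant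
      3.\<close>
    have "norm (W l t - W0 l) \<le> 3 * S t" for t
    proof -
      have le: "\<bar>Z t i - z0 i\<bar> \<le> S t" if "i < 2 * n + 1" for i
        unfolding S_def using that by (intro member_le_sum) auto
      have "norm (a, b, c) \<le> \<bar>a\<bar> + (\<bar>b\<bar> + \<bar>c\<bar>)" for a b c :: real
        using norm_Pair_le[of a "(b, c)"] norm_Pair_le[of b c] by simp
      from this[of "Z t l - z0 l" "Z t (n + l) - z0 (n + l)" "Z t (2 * n) - z0 (2 * n)"]
      show ?thesis using le[of l] le[of "n + l"] le[of "2 * n"] l by (simp add: W_def W0_def)
    qed
    also have "3 * S t \<le> 3 * norm (S t)" for t by simp
    finally show "(\<lambda>t. norm (W l t - W0 l)) \<in> O[F](S)"
      by (intro bigoI[where c = 3] always_eventually) simp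
  qed
  have "(\<lambda>t. \<Sum>l<n. h (W l t) - h (W0 l) - h' l (W l t - W0 l)) \<in> o[F](S)"
    by (intro big_sum_in_smallo) (use small in auto)
  moreover have "(\<Sum>l<n. h (W l t) - h (W0 l) - h' l (W l t - W0 l))
      = moment m n q (Z t) - moment m n q z0
            - (\<Sum>i<2 * n + 1. dmoment m n q z0 i * (Z t i - z0 i))" for t
  proof -
    have "(\<Sum>i<2 * n + 1. dmoment m n q z0 i * (Z t i - z0 i)) = (\<Sum>l<n. h' l (W l t - W0 l))"
      unfolding sum_blocks
      by (simp add: dmoment_def h'_def W_def W0_def T_def E_def N_def sum.distrib sum_distrib_right)
    moreover have "moment m n q (Z t) = (\<Sum>l<n. h (W l t))" "moment m n q z0 = (\<Sum>l<n. h (W0 l))"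
      by (simp_all add: moment_def h_def W_def W0_def N_def)
    ultimately show ?thesis by (simp add: sum_subtractf)
  qed
  ultimately show ?thesis by (simp add: S_def[abs_def])
qed

lemma continuous_on_moment: "continuous_on A (moment m n q)"
proof -
  have c: "continuous_on A (\<lambda>z :: nat \<Rightarrow> real. z i)" for i
    by (rule continuous_on_subset[OF continuous_on_product_coordinates subset_UNIV])
  show ?thesis
    unfolding moment_def dop_sym_poly poly_sum poly_smult
    by (intro continuous_on_sum continuous_on_mult continuous_on_const continuous_on_power
        continuous_on_poly c)
qed

text \<open>By linearity, a combination of rows of the Jacobian is the gradient belonging to a
  single polynomial, so left null vectors can be handled as polynomials.\<close>

lemma dmoment_sum:
  "dmoment m n (\<Sum>k\<in>A. smult (x k) (q k)) z i = (\<Sum>k\<in>A. x k * dmoment m n (q k) z i)"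
proof -
  have swap: "(\<Sum>l<n. z l * (\<Sum>k\<in>A. x k * c k l)) = (\<Sum>k\<in>A. x k * (\<Sum>l<n. z l * c k l))" for c
    unfolding sum_distrib_left by (subst sum.swap) (simp only: mult.left_commute)
  show ?thesis
    unfolding dmoment_def dop_sum_right dop_smult_right pderiv_sum pderiv_smult poly_sum poly_smult swap
    by (simp add: sum_distrib_left mult.left_commute)
qed

lemma dmoment_diff: "dmoment m n (p - q) z i = dmoment m n p z i - dmoment m n q z i"
  by (simp add: dmoment_def dop_diff_right pderiv_diff right_diff_distrib sum_subtractf)

section \<open>The numbers b_j as coefficients of 1/F, and the factorization from the roots of
  p\<close>

lemma bnum_convolution:
  assumes "kmom K 0 = 1"
  shows "(\<Sum>k\<le>j. kmom K k / fact k * bnum K (j - k)) = (if j = 0 then 1 else 0)"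
proof (cases j)
  case (Suc i)
  have "{..j} = insert 0 {1..j}" by auto
  then show ?thesis using assms by (simp add: Suc)
qed (use assms in simp)

text \<open>The coefficient of X^j in the product is sigma^j times the j-th convolution of b with
  m_k / k!; truncation at N does not affect it for j up to N.\<close>

lemma bnum_poly_mult_sym_poly:
  assumes "kmom K 0 = 1"
  shows "monom 1 (Suc N) dvd
    (\<Sum>k\<le>N. monom (bnum K k * \<sigma> ^ k) k) * sym_poly (kmom K) N \<sigma> - 1"
proof -
  let ?B = "\<Sum>k\<le>N. monom (bnum K k * \<sigma> ^ k) k"
  have "coeff (?B * sym_poly (kmom K) N \<sigma> - 1) j = 0" if j: "j < Suc N" for j
  proof -
    have B: "coeff ?B k = bnum K k * \<sigma> ^ k" if "k \<le> N" for k
      using that by (simp add: coeff_sum)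
    have F: "coeff (sym_poly (kmom K) N \<sigma>) k = kmom K k / fact k * \<sigma> ^ k" if "k \<le> N" for k
      using that by (simp add: sym_poly_def coeff_sum)
    have "coeff (?B * sym_poly (kmom K) N \<sigma>) j
        = (\<Sum>k\<le>j. coeff (sym_poly (kmom K) N \<sigma>) k * coeff ?B (j - k))"
      by (subst mult.commute) (rule coeff_mult)
    also have "\<dots> = (\<Sum>k\<le>j. \<sigma> ^ j * (kmom K k / fact k * bnum K (j - k)))"
    proof (rule sum.cong)
      fix k assume k: "k \<in> {..j}"
      then have "\<sigma> ^ j = \<sigma> ^ k * \<sigma> ^ (j - k)" by (simp flip: power_add)
      then show "coeff (sym_poly (kmom K) N \<sigma>) k * coeff ?B (j - k)
          = \<sigma> ^ j * (kmom K k / fact k * bnum K (j - k))"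
        using k j by (subst B, simp, subst F, simp, simp)
    qed simp
    also have "\<dots> = (if j = 0 then 1 else 0)"
      unfolding sum_distrib_left[symmetric] bnum_convolution[OF assms] by simp
    finally show ?thesis by (simp add: coeff_1)
  qed
  then show ?thesis by (simp add: monom_1_dvd_iff')
qed

text \<open>Reversing the coefficients turns p into the sum of b_k X^k and each factor t - r_i into
  1 - r_i X; then X is replaced by sigma X.\<close>

lemma bnum_poly_factorization:
  assumes "ppoly K n = (\<Prod>i<2 * n + 1. [:- r i, 1:])"
  shows "(\<Sum>k\<le>2 * n + 1. monom (bnum K k * \<sigma> ^ k) k) = (\<Prod>i<2 * n + 1. [:1, - (\<sigma> * r i):])"
proof -
  let ?N = "2 * n + 1"
  have coeff_p: "coeff (ppoly K n) j = (if j \<le> ?N then bnum K (?N - j) else 0)" for j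
    by (simp add: ppoly_def coeff_sum del: bnum.simps)
  \<comment> \<open>Reversal is relative to the actual degree, which is 2n + 1 because b_0 =
    1.\<close>
  have deg: "degree (ppoly K n) = ?N"
  proof (rule antisym)
    show "degree (ppoly K n) \<le> ?N" by (rule degree_le) (simp add: coeff_p)
    show "?N \<le> degree (ppoly K n)" by (rule le_degree) (simp add: coeff_p)
  qed
  have "reflect_poly (ppoly K n) = (\<Sum>k\<le>?N. monom (bnum K k) k)"
    by (rule poly_eqI) (auto simp: coeff_reflect_poly deg coeff_p coeff_sum simp del: bnum.simps)
  moreover have "reflect_poly [:- r i, 1:] = [:1, - r i:]" for i
    by (simp add: reflect_poly_pCons' monom_Suc monom_0)
  then have "reflect_poly (ppoly K n) = (\<Prod>i<?N. [:1, - r i:])"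
    unfolding assms reflect_poly_prod by simp
  ultimately have eq: "(\<Sum>k\<le>?N. monom (bnum K k) k) = (\<Prod>i<?N. [:1, - r i:])" by simp
  have "poly (\<Sum>k\<le>?N. monom (bnum K k * \<sigma> ^ k) k) x = poly (\<Prod>i<?N. [:1, - (\<sigma> * r i):]) x" for x
  proof -
    have "poly (\<Sum>k\<le>?N. monom (bnum K k * \<sigma> ^ k) k) x = poly (\<Sum>k\<le>?N. monom (bnum K k) k) (\<sigma> * x)"
      unfolding poly_sum poly_monom power_mult_distrib by (simp only: mult.assoc)
    also have "\<dots> = poly (\<Prod>i<?N. [:1, - (\<sigma> * r i):]) x"
      unfolding eq poly_prod by (rule prod.cong) simp_all
    finally show ?thesis .
  qed
  then show ?thesis by (rule poly_eq_poly_eq_iff[THEN iffD1, OF ext])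
qed

section \<open>The parameters as vectors of length 2n + 1\<close>

definition unpack :: "nat \<Rightarrow> (nat \<Rightarrow> real) \<Rightarrow> (nat \<Rightarrow> real) \<times> (nat \<Rightarrow> real) \<times> real" where
  "unpack n z = (\<lambda>i. if i < n then z i else 0, \<lambda>i. if i < n then z (n + i) else 0, z (2 * n))"

definition Omega_vec :: "nat \<Rightarrow> (nat \<Rightarrow> real) set" where
  "Omega_vec n = {z. (\<forall>i\<ge>2 * n + 1. z i = 0) \<and> (\<forall>i<n. 0 < z i) \<and>
     (\<forall>i j. i < j \<and> j < n \<longrightarrow> z (n + i) < z (n + j)) \<and> 0 < z (2 * n)}"

lemma unpack_in_Omega: "z \<in> Omega_vec n \<Longrightarrow> unpack n z \<in> Omega n"
  by (auto simp: Omega_vec_def Omega_def unpack_def)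

lemma Omega_unpackE:
  assumes "W \<in> Omega n"
  obtains z where "z \<in> Omega_vec n" "unpack n z = W"
proof -
  obtain w u \<sigma> where W: "W = (w, u, \<sigma>)" by (cases W) auto
  define z where "z i = (if i < n then w i else if i < 2 * n then u (i - n)
      else if i = 2 * n then \<sigma> else 0)" for i
  have "z \<in> Omega_vec n" using assms by (auto simp: W z_def Omega_vec_def Omega_def)
  moreover have "unpack n z = W" using assms by (auto simp: W z_def unpack_def Omega_def fun_eq_iff)
  ultimately show ?thesis using that by blast
qed

lemma inj_on_unpack: "inj_on (unpack n) (Omega_vec n)"
proof (rule inj_onI)
  fix x y assume xy: "x \<in> Omega_vec n" "y \<in> Omega_vec n" and eq: "unpack n x = unpack n y"
  have low: "x i = y i" and mid: "x (n + i) = y (n + i)" if "i < n" for i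
    using eq that by (auto simp: unpack_def fun_eq_iff dest: spec[of _ i])
  have top: "x (2 * n) = y (2 * n)" using eq by (simp add: unpack_def)
  show "x = y"
  proof
    fix i
    consider "i < n" | "n \<le> i" "i < 2 * n" | "i = 2 * n" | "2 * n + 1 \<le> i" by linarith
    then show "x i = y i"
    proof cases
      case 2
      then show ?thesis using mid[of "i - n"] by simp
    qed (use low top xy in \<open>auto simp: Omega_vec_def\<close>)
  qed
qed

text \<open>Finitely many strict inequalities between coordinates cut out the set; its openness is
  needed for invariance of domain.\<close>

lemma openin_Omega_vec: "openin (Euclidean_space (2 * n + 1)) (Omega_vec n)"
proof -
  define W where "W = (\<Inter>i\<in>{..<n}. {z :: nat \<Rightarrow> real. 0 < z i}) \<inter>
    (\<Inter>j\<in>{..<n}. \<Inter>i\<in>{..<j}. {z. z (n + i) < z (n + j)}) \<inter> {z. 0 < z (2 * n)}"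
  have "open {z :: nat \<Rightarrow> real. 0 < z i}" "open {z :: nat \<Rightarrow> real. z i < z j}" for i j
    by (intro open_Collect_less continuous_on_const continuous_on_product_coordinates)+
  then have "open W" unfolding W_def by (intro open_Int open_INT finite_lessThan ballI) auto
  moreover have "Omega_vec n = {x. \<forall>i\<ge>2 * n + 1. x i = 0} \<inter> W"
    by (auto simp: Omega_vec_def W_def)
  ultimately show ?thesis
    by (auto simp: Euclidean_space_def euclidean_product_topology openin_open)
qed

lemma momap_unpack:
  "momap K n (unpack n z) = (\<lambda>k. if k < 2 * n + 1 then moment (kmom K) n (monom 1 k) z else 0)"
  by (rule ext) (auto simp: momap_def unpack_def moment_def Delta_eq_dop[where N = "2 * n + 1"])

lemma closure_mom_unpack:
  assumes "inj_on (momap K n) (Omega n)" "z \<in> Omega_vec n"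
  shows "closure_mom K n (momap K n (unpack n z)) = moment (kmom K) n (monom 1 (2 * n + 1)) z"
  using the_inv_into_f_f[OF assms(1) unpack_in_Omega[OF assms(2)]]
  by (simp add: closure_mom_def unpack_def moment_def Delta_eq_dop[where N = "2 * n + 1"])

text \<open>The weight block of the gradient yields the zeros of F(sigma D) q at the nodes, the node
  block the zeros of its derivative, as the weights are positive, and the last entry the vanishing
  sum.\<close>

lemma dmoment_eq_0_imp_zero:
  fixes s :: "'i \<Rightarrow> real"
  assumes n: "n \<ge> 1" and z: "z \<in> Omega_vec n" and I: "finite I" "\<exists>i\<in>I. s i \<noteq> 0"
    and BF: "monom 1 (Suc (2 * n + 1)) dvd
      (\<Prod>i\<in>I. [:1, - s i:]) * sym_poly m (2 * n + 1) (z (2 * n)) - 1"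
    and deg: "degree q \<le> 2 * n" and zero: "\<And>i. i < 2 * n + 1 \<Longrightarrow> dmoment m n q z i = 0"
  shows "q = 0"
proof (rule sum_dsigma_eq_0_imp_zero[OF I(1) refl BF n _ _ _ I(2) deg])
  let ?\<sigma> = "z (2 * n)"
  have wpos: "0 < z l" and upos: "z (n + l) = z (n + k) \<longleftrightarrow> l = k" if "l < n" "k < n" for l k
    using z that by (auto simp: Omega_vec_def) (metis less_irrefl linorder_neqE_nat)
  show "inj_on (\<lambda>l. z (n + l)) {..<n}" using upos by (auto simp: inj_on_def)
  fix l assume l: "l < n"
  show "0 < z l" using wpos l by blast
  show "poly (dop (sym_poly m (2 * n + 1) ?\<sigma>) q) (z (n + l)) = 0"
    using zero[of l] l by (simp add: dmoment_def)
  show "poly (pderiv (dop (sym_poly m (2 * n + 1) ?\<sigma>) q)) (z (n + l)) = 0"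
    using zero[of "n + l"] wpos[OF l l] l by (simp add: dmoment_def)
next
  let ?\<sigma> = "z (2 * n)"
  have "(\<Sum>l<n. z l * poly (dop (dsym_poly m (2 * n + 1) ?\<sigma>) q) (z (n + l))) = 0"
    using zero[of "2 * n"] by (simp add: dmoment_def)
  \<comment> \<open>Multiplication by sigma replaces d/dsigma by X d/dX.\<close>
  then show "(\<Sum>l<n. z l * poly (dop (monom 1 1 * pderiv (sym_poly m (2 * n + 1) ?\<sigma>)) q) (z (n + l))) = 0"
    unfolding smult_dsym_poly[symmetric] dop_smult_left poly_smult
    by (simp add: mult.left_commute[of _ ?\<sigma>] sum_distrib_left[symmetric])
qed simp

text \<open>F(D) c is monic of degree 2n + 1, so beside the double zeros one real linear factor
  remains. Its zero may be a node, hence the bound 3 on the multiplicities; two nonzero s_i bring it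
  down to 1.\<close>

lemma card_roots_of_double_interpolation:
  fixes s :: "'i \<Rightarrow> real"
  assumes u: "inj_on u {..<n}" and I: "finite I" "card {i \<in> I. s i \<noteq> 0} \<ge> 2"
    and BF: "monom 1 (Suc (2 * n + 1)) dvd (\<Prod>i\<in>I. [:1, - s i:]) * F - 1"
    and F: "coeff F 0 = 1" and c: "degree c = 2 * n + 1" "lead_coeff c = 1"
    and g0: "\<And>l. l < n \<Longrightarrow> poly (dop F c) (u l) = 0"
    and g1: "\<And>l. l < n \<Longrightarrow> poly (pderiv (dop F c)) (u l) = 0"
  shows "card {x. poly c x = 0} = 2 * n + 1"
proof -
  let ?us = "map u [0..<n]"
  define g where "g = dop F c"
  have deg_g: "degree g = 2 * n + 1" and lc_g: "lead_coeff g = 1"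
    unfolding g_def using degree_dop[of F c] lead_coeff_dop[of F c] F c by simp_all
  obtain h where h: "g = sq_prod n u * h"
    using sq_prod_dvd[OF u, of g] g0 g1 unfolding g_def dvd_def by blast
  have "g \<noteq> 0" using deg_g by auto
  then have "degree g = 2 * n + degree h"
    unfolding h by (subst degree_mult_eq) (auto simp: degree_sq_prod)
  then have deg_h: "degree h = 1" using deg_g by simp
  have "lead_coeff h = 1" using lc_g unfolding h lead_coeff_mult lead_coeff_sq_prod by simp
  with deg_h obtain b where b: "h = [:b, 1:]"
    by (metis One_nat_def degree1_coeffs coeff_pCons_Suc coeff_pCons_0)
  have g_lin: "g = lin_prod ((- b) # ?us @ ?us)"
    unfolding h b sq_prod_eq_lin_prod by (simp add: lin_prod_append ac_simps)
  have "distinct ?us" using u by (simp add: distinct_map atLeast0LessThan)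
  then have count: "count_list ?us a \<le> 1" for a
    by (simp add: distinct_count_atmost_1 count_mset[symmetric])
  have "order a (lin_prod ((- b) # ?us @ ?us)) \<le> 3" for a
    unfolding order_lin_prod using count[of a] by (simp add: count_list_append)
  from dop_prod_real_rooted[OF I(1) this, of s]
  obtain bs where bs: "dop (\<Prod>i\<in>I. [:1, - s i:]) g = lin_prod bs"
    and ord: "\<And>a. order a (lin_prod bs) \<le> max 1 (3 - card {i \<in> I. s i \<noteq> 0})"
    unfolding g_lin by blast
  have c_eq: "c = lin_prod bs"
    using dop_prod_inverse[OF I(1) refl BF, of c] c(1) bs by (simp add: g_def)
  have "max 1 (3 - card {i \<in> I. s i \<noteq> 0}) = 1" using I(2) by simp
  then have "distinct bs" using ord distinct_if_simple by metis
  moreover have "{x. poly c x = 0} = set bs" by (auto simp: c_eq poly_lin_prod_eq_0_iff)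
  moreover have "length bs = 2 * n + 1" using c(1) by (simp add: c_eq degree_lin_prod)
  ultimately show ?thesis by (simp add: distinct_card)
qed

section \<open>Strict hyperbolicity\<close>

lemma dmoment_coeff_kernel:
  assumes N: "N = 2 * n + 1"
    and ker: "\<forall>q. degree q \<le> 2 * n \<longrightarrow> (\<forall>i<N. dmoment m n q z i = 0) \<longrightarrow> q = 0"
  shows "\<forall>x. (\<forall>i<N. (\<Sum>k<N. x k * dmoment m n (monom 1 k) z i) = 0) \<longrightarrow> (\<forall>k<N. x k = 0)"
proof (intro allI impI)
  fix x k
  assume x: "\<forall>i<N. (\<Sum>k<N. x k * dmoment m n (monom 1 k) z i) = 0" and k: "k < N"
  let ?q = "\<Sum>k<N. smult (x k) (monom 1 k)"
  have "degree ?q \<le> 2 * n"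
  proof (rule degree_sum_le)
    show "degree (smult (x i) (monom 1 i)) \<le> 2 * n" if "i \<in> {..<N}" for i
      using that degree_monom_le[of "x i" i] by (simp add: smult_monom N)
  qed simp
  moreover have "\<forall>i<N. dmoment m n ?q z i = 0" using x by (simp only: dmoment_sum simp_thms)
  ultimately have "?q = 0" using ker by blast
  then have "coeff ?q k = 0" by simp
  moreover have "coeff ?q k = x k"
    using k unfolding coeff_sum smult_monom coeff_monom by simp
  ultimately show "x k = 0" by simp
qed

text \<open>Along the path that inverts the moment map in direction \<open>j\<close>, the closure is
  the moment of x^(2n+1). The system for \<open>a\<close> is the chain rule: the gradient of that
  moment as a combination of the Jacobian rows.\<close>

lemma acoef_eq:
  fixes K :: "real \<Rightarrow> real" and n N j :: nat and a z0 :: "nat \<Rightarrow> real"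
  assumes inj: "inj_on (momap K n) (Omega n)" and z0: "z0 \<in> Omega_vec n"
    and N: "N = 2 * n + 1"
    and ker: "\<forall>q. degree q \<le> 2 * n \<longrightarrow> (\<forall>i<N. dmoment (kmom K) n q z0 i = 0) \<longrightarrow> q = 0"
    and a: "\<forall>i<N. (\<Sum>k<N. a k * dmoment (kmom K) n (monom 1 k) z0 i)
      = dmoment (kmom K) n (monom 1 N) z0 i"
    and j: "j < N"
  shows "acoef K n (momap K n (unpack n z0)) j = a j"
proof -
  define f where "f z = momap K n (unpack n z)" for z
  define D where "D k = dmoment (kmom K) n (monom 1 k) z0" for k
  have f: "f z = (\<lambda>k. if k < N then moment (kmom K) n (monom 1 k) z else 0)" for z
    by (simp add: f_def momap_unpack N)
  have f_inj: "inj_on f (Omega_vec n)"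
  proof -
    have "unpack n ` Omega_vec n \<subseteq> Omega n" using unpack_in_Omega by blast
    then have "inj_on (momap K n \<circ> unpack n) (Omega_vec n)"
      by (intro comp_inj_on[OF inj_on_unpack] inj_on_subset[OF inj])
    then show ?thesis by (simp add: f_def[abs_def] comp_def)
  qed
  have f_eq: "f = (\<lambda>z k. if k < N then moment (kmom K) n (monom 1 k) z else 0)"
    by (simp add: fun_eq_iff f)
  have open_U: "openin (Euclidean_space N) (Omega_vec n)"
    unfolding N by (rule openin_Omega_vec)
  obtain Z where Z: "\<And>i. ((\<lambda>t. Z t i) \<longlongrightarrow> z0 i) (at (f z0 j))"
    and Z_ev: "\<forall>\<^sub>F t in nhds (f z0 j). Z t \<in> Omega_vec n \<and> f (Z t) = (f z0)(j := t)"
    and Z0: "Z (f z0 j) = z0"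
    by (rule inverse_path[OF f_eq open_U continuous_on_moment f_inj z0 j]) (rule that)
  define t0 where "t0 = f z0 j"
  have Zt0: "Z t0 = z0" using Z0 by (simp add: t0_def)
  have left_inv: "\<exists>x. \<forall>l<N. (\<Sum>k<N. x k * D k l) = (if l = i then 1 else 0)" for i
    unfolding D_def by (rule surj_of_trivial_left_kernel[OF dmoment_coeff_kernel[OF N ker]])
  have expansion: "(\<lambda>t. moment (kmom K) n q (Z t) - moment (kmom K) n q (Z t0)
            - (\<Sum>i<N. dmoment (kmom K) n q z0 i * (Z t i - z0 i)))
         \<in> o[at t0](\<lambda>t. \<Sum>i<N. \<bar>Z t i - z0 i\<bar>)" for q
    unfolding Zt0 N by (rule moment_expansion[OF Z[folded t0_def]])
  have "((\<lambda>t. moment (kmom K) n (monom 1 N) (Z t)) has_real_derivative a j) (at t0)"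
  proof (rule deriv_along_inverse_path[where z = Z and ?z0.0 = z0 and N = N and D = D
        and \<phi> = "\<lambda>k t. moment (kmom K) n (monom 1 k) (Z t)"
        and d = "dmoment (kmom K) n (monom 1 N) z0"])
    show "\<forall>\<^sub>F t in at t0. moment (kmom K) n (monom 1 k) (Z t) - moment (kmom K) n (monom 1 k) (Z t0)
        = (if k = j then t - t0 else 0)" if k: "k < N" for k
    proof -
      have "moment (kmom K) n (monom 1 k) (Z t) - moment (kmom K) n (monom 1 k) (Z t0)
          = (if k = j then t - t0 else 0)" if "f (Z t) = (f z0)(j := t)" for t
      proof -
        have "f (Z t) k - f (Z t0) k = (if k = j then t - t0 else 0)"
          using that Z0 by (auto simp: t0_def)
        then show ?thesis using k by (simp add: f)
      qed
      then show ?thesis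
        unfolding eventually_at_filter t0_def[symmetric]
        using Z_ev[folded t0_def] by (auto elim!: eventually_mono)
    qed
    show "(\<Sum>k<N. a k * D k i) = dmoment (kmom K) n (monom 1 N) z0 i" if "i < N" for i
      using a that by (simp add: D_def)
    show "j < N" by (rule j)
    show "(\<lambda>t. moment (kmom K) n (monom 1 k) (Z t) - moment (kmom K) n (monom 1 k) (Z t0)
            - (\<Sum>i<N. D k i * (Z t i - z0 i))) \<in> o[at t0](\<lambda>t. \<Sum>i<N. \<bar>Z t i - z0 i\<bar>)" for k
      unfolding D_def by (rule expansion)
  qed (rule expansion left_inv)+
  \<comment> \<open>The two functions agree on a full neighbourhood, with \<open>t0\<close>
    included, so the derivative can be transferred.\<close>
  moreover have ev: "\<forall>\<^sub>F t in nhds t0. moment (kmom K) n (monom 1 N) (Z t)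
      = closure_mom K n ((f z0)(j := t))"
    using Z_ev[folded t0_def]
  proof (rule eventually_mono)
    fix t assume "Z t \<in> Omega_vec n \<and> f (Z t) = (f z0)(j := t)"
    then show "moment (kmom K) n (monom 1 N) (Z t) = closure_mom K n ((f z0)(j := t))"
      using closure_mom_unpack[OF inj, of "Z t"] by (simp add: f_def N)
  qed
  ultimately have "((\<lambda>t. closure_mom K n ((f z0)(j := t))) has_real_derivative a j) (at t0)"
    unfolding DERIV_cong_ev[OF refl ev refl] by simp
  then show ?thesis
    unfolding acoef_def f_def[symmetric] t0_def by (rule DERIV_imp_deriv)
qed

theorem theorem2p8:
  fixes K :: "real \<Rightarrow> real" and n :: nat
  assumes "kernel_ok K"
    and "n \<ge> 1"
    and "inj_on (momap K n) (Omega n)"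
    and "\<exists>r :: nat \<Rightarrow> real. ppoly K n = (\<Prod>i<2 * n + 1. [:- r i, 1:])
           \<and> card {i. i < 2 * n + 1 \<and> r i \<noteq> 0} \<ge> 2"
  shows "\<forall>M \<in> momap K n ` Omega n.
           card {ev. eigenvalue (Amat K n M) (ev::real)} = 2 * n + 1"
proof
  fix M assume "M \<in> momap K n ` Omega n"
  then obtain z0 where z0: "z0 \<in> Omega_vec n" and M: "M = momap K n (unpack n z0)"
    by (metis imageE Omega_unpackE)
  obtain r where r: "ppoly K n = (\<Prod>i<2 * n + 1. [:- r i, 1:])"
    and card_r: "card {i. i < 2 * n + 1 \<and> r i \<noteq> 0} \<ge> 2"
    using assms(4) by blast
  define N where "N = 2 * n + 1"
  define \<sigma> where "\<sigma> = z0 (2 * n)"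
  define s where "s i = \<sigma> * r i" for i
  define I where "I = {..<N}"
  define F where "F = sym_poly (kmom K) N \<sigma>"
  have \<sigma>: "\<sigma> > 0" using z0 by (simp add: \<sigma>_def Omega_vec_def)
  have K0: "kmom K 0 = 1" using assms(1) by (simp add: kernel_ok_def)
  \<comment> \<open>Scaling the roots by sigma > 0 does not change which of them are zero.\<close>
  have "{i \<in> I. s i \<noteq> 0} = {i. i < 2 * n + 1 \<and> r i \<noteq> 0}"
    using \<sigma> by (auto simp: I_def N_def s_def)
  then have card_s: "card {i \<in> I. s i \<noteq> 0} \<ge> 2" using card_r by simp
  then have ex_s: "\<exists>i\<in>I. s i \<noteq> 0"
    by (metis (mono_tags, lifting) Collect_empty_eq card.empty not_numeral_le_zero)
  have BF: "monom 1 (Suc N) dvd (\<Prod>i\<in>I. [:1, - s i:]) * F - 1"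
    using bnum_poly_mult_sym_poly[OF K0, of N \<sigma>] bnum_poly_factorization[OF r, of \<sigma>]
    by (simp add: F_def I_def s_def N_def)
  have fin: "finite I" by (simp add: I_def)
  have ker: "\<forall>q. degree q \<le> 2 * n \<longrightarrow> (\<forall>i<N. dmoment (kmom K) n q z0 i = 0) \<longrightarrow> q = 0"
  proof (intro allI impI)
    fix q assume "degree q \<le> 2 * n" "\<forall>i<N. dmoment (kmom K) n q z0 i = 0"
    then show "q = 0"
      by (intro dmoment_eq_0_imp_zero[OF assms(2) z0 fin ex_s BF[unfolded F_def N_def \<sigma>_def]])
        (simp_all add: N_def)
  qed
  \<comment> \<open>The solution of the chain-rule system is taken first; \<open>acoef_eq\<close>
    then identifies it with the partial derivatives of the closure.\<close>
  obtain a where a: "\<forall>i<N. (\<Sum>k<N. a k * dmoment (kmom K) n (monom 1 k) z0 i)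
      = dmoment (kmom K) n (monom 1 N) z0 i"
    using surj_of_trivial_left_kernel[OF dmoment_coeff_kernel[OF N_def ker]] ..
  have "Amat K n M = mat (2 * n + 1) (2 * n + 1)
      (\<lambda>(i, j). if i = 2 * n then a j else if j = i + 1 then 1 else 0)"
    unfolding Amat_def M
    by (rule cong_mat) (use acoef_eq[OF assms(3) z0 N_def ker a] in \<open>auto simp: N_def\<close>)
  then have ev: "eigenvalue (Amat K n M) x \<longleftrightarrow> x ^ N = (\<Sum>k<N. a k * x ^ k)" for x
    using eigenvalue_companion_iff[where a = a and m = "2 * n"] by (simp only: N_def)
  \<comment> \<open>The characteristic polynomial of A(M).\<close>
  define c where "c = monom 1 N - (\<Sum>k<N. smult (a k) (monom 1 k))"
  have coeff_c: "coeff c k = (if k = N then 1 else if k < N then - a k else 0)" for k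
    by (auto simp: c_def coeff_sum smult_monom)
  have deg_c: "degree c = N"
    by (rule antisym[OF degree_le le_degree]) (simp_all add: coeff_c)
  \<comment> \<open>The chain rule in terms of \<open>c\<close>; its weight and node entries give
    the double zeros of F(sigma D) c.\<close>
  have dc: "dmoment (kmom K) n c z0 i = 0" if "i < N" for i
    unfolding c_def dmoment_diff dmoment_sum using a that by simp
  have wpos: "0 < z0 l" and ueq: "z0 (n + l) = z0 (n + k) \<longleftrightarrow> l = k" if "l < n" "k < n" for l k
    using z0 that by (auto simp: Omega_vec_def) (metis less_irrefl linorder_neqE_nat)
  have "card {x. poly c x = 0} = 2 * n + 1"
  proof (rule card_roots_of_double_interpolation[where u = "\<lambda>l. z0 (n + l)" and F = F])
    show "finite I" by (rule fin)
    show "card {i \<in> I. s i \<noteq> 0} \<ge> 2" by (rule card_s)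
    show "monom 1 (Suc (2 * n + 1)) dvd (\<Prod>i\<in>I. [:1, - s i:]) * F - 1"
      using BF by (simp add: N_def)
    show "inj_on (\<lambda>l. z0 (n + l)) {..<n}" using ueq by (auto simp: inj_on_def)
    show "coeff F 0 = 1" by (simp add: F_def sym_poly_def coeff_sum K0)
    show "degree c = 2 * n + 1" "lead_coeff c = 1" by (simp_all add: deg_c coeff_c N_def)
    fix l assume l: "l < n"
    show "poly (dop F c) (z0 (n + l)) = 0"
      using dc[of l] l by (simp add: dmoment_def F_def N_def \<sigma>_def)
    show "poly (pderiv (dop F c)) (z0 (n + l)) = 0"
      using dc[of "n + l"] wpos[OF l l] l by (simp add: dmoment_def F_def N_def \<sigma>_def)
  qed
  moreover have "{ev. eigenvalue (Amat K n M) ev} = {x. poly c x = 0}"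
    by (simp add: ev c_def poly_sum poly_monom)
  ultimately show "card {ev. eigenvalue (Amat K n M) ev} = 2 * n + 1" by simp
qed

end
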